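(* For every $\varepsilon>0$ there is a constant $c_\varepsilon>0$ such that for almost all integers $E$ which are sums of two squares the following holds, with $\lambda=\sqrt{E}$: for every (nonzero, real-valued) eigenfunction $\varphi$ of the Laplacian on $\mathbb{T}^2$ with eigenvalue $E$ (in the normalization of the context) and every regular arc $C$ contained in the nodal set $\mathcal{N}_\varphi$, $$w(C)<c_\varepsilon\,\lambda^{-1+\varepsilon}.$$ Here "almost all" means that the number of exceptional $E\le N$, divided by the number of $E\le N$ which are sums of two squares, tends to $0$ as $N\to\infty$.
   Context: $\mathbb{T}^2=\mathbb{R}^2/\mathbb{Z}^2$ is the standard flat torus and $e(t)=\exp(2\pi i t)$. An eigenfunction with eigenvalue $E=\lambda^2$ (the Laplace eigenvalue is actually $4\pi^2E$; $E\geq 1$ is an integer which is a sum of two squares) is a nonzero real-valued function $\varphi(x)=\sum_{\xi\in\mathbb{Z}^2,\ |\xi|^2=E}a_\xi\, e(x\cdot\xi)$ with $\overline{a_\xi}=a_{-\xi}$. Its nodal set is $\mathcal{N}_\varphi=\{x\in\mathbb{T}^2:\varphi(x)=0\}$. Regular arc: an arc $C\subset\mathbb{T}^2$ is regular if it admits an arc-length parametrization $\gamma:[0,\ell]\to C$, $0<\ell<1$, which is $C^2$ and such that for some $\kappa>0$ one has $\kappa<|\ddot\gamma|<2\kappa$ pointwise and $2\kappa\ell<1$. Width: for a convex curve $C$ in the plane, the width $w(C)$ is the minimal distance between a pair of parallel supporting lines of the curve. A regular arc in $\mathbb{T}^2$ is viewed as a planar (convex) arc by lifting to $\mathbb{R}^2$.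 The number of integers $E\le N$ which are sums of two squares is asymptotic to a constant multiple of $N/\sqrt{\log N}$. *)

theory Defs
  imports "HOL-Analysis.Analysis"
begin

definition integer_lattice :: "(real ^ 2) set" where
  "integer_lattice = {v. \<forall>i. v $ i \<in> \<int>}"

definition torus_rel :: "real ^ 2 \<Rightarrow> real ^ 2 \<Rightarrow> bool" where
  "torus_rel x y \<longleftrightarrow> x - y \<in> integer_lattice"

quotient_type torus = "real ^ 2" / torus_rel
  morphisms rep_torus torus_proj
proof (rule equivpI)
  show "reflp torus_rel"
    by (auto simp: reflp_def torus_rel_def integer_lattice_def)
  show "symp torus_rel"
    unfolding symp_def torus_rel_def integer_lattice_def
    by (auto, metis Ints_minus minus_diff_eq)
  show "transp torus_rel"
    unfolding transp_def torus_rel_def integer_lattice_def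
    by (auto, metis Ints_add diff_add_cancel add_diff_eq)
qed

lemma torus_proj_eq_iff: "torus_proj x = torus_proj y \<longleftrightarrow> x - y \<in> integer_lattice"
  by (simp add: torus.abs_eq_iff torus_rel_def)

definition unit_character :: "real \<Rightarrow> complex" where
  "unit_character t = exp (2 * of_real pi * \<i> * of_real t)"

definition frequencies :: "nat \<Rightarrow> (real ^ 2) set" where
  "frequencies E = {\<xi> \<in> integer_lattice. (norm \<xi>)\<^sup>2 = real E}"

lemma finite_frequencies: "finite (frequencies E)"
proof -
  define J where "J = {r::real. r \<in> \<int> \<and> \<bar>r\<bar> \<le> sqrt (real E)}"
  have J: "finite J"
    unfolding J_def by (rule finite_abs_int_segment)
  have "(\<xi> $ 1, \<xi> $ 2) \<in> J \<times> J" if \<xi>: "\<xi> \<in> frequencies E" for \<xi>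
  proof -
    have "sqrt (real E) = norm \<xi>"
      using \<xi> by (metis (lifting) frequencies_def mem_Collect_eq norm_ge_zero real_sqrt_unique)
    moreover have "\<xi> $ i \<in> \<int>" for i
      using \<xi> unfolding frequencies_def integer_lattice_def by blast
    ultimately show ?thesis
      unfolding J_def using component_le_norm_cart by (metis (lifting) SigmaI mem_Collect_eq)
  qed
  then have "(\<lambda>\<xi>. (\<xi> $ 1, \<xi> $ 2)) ` frequencies E \<subseteq> J \<times> J"
    by (rule image_subsetI)
  then have "finite ((\<lambda>\<xi>. (\<xi> $ 1, \<xi> $ 2)) ` frequencies E)"
    by (rule finite_subset) (rule finite_cartesian_product[OF J J])
  moreover have "inj_on (\<lambda>\<xi>. (\<xi> $ 1, \<xi> $ 2)) (frequencies E)"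
    by (rule inj_onI) (simp add: vec_eq_iff forall_2)
  ultimately show ?thesis
    by (rule finite_imageD)
qed

text \<open>The Laplace eigenvalue of these functions is \<open>4 * pi\<^sup>2 * E\<close>.\<close>

definition eigenfunction :: "nat \<Rightarrow> (torus \<Rightarrow> real) \<Rightarrow> bool" where
  "eigenfunction E \<phi> \<longleftrightarrow>
     (\<exists>p. \<phi> p \<noteq> 0) \<and>
     (\<exists>a :: real ^ 2 \<Rightarrow> complex.
        (\<forall>\<xi> \<in> frequencies E. cnj (a \<xi>) = a (- \<xi>)) \<and>
        (\<forall>x. complex_of_real (\<phi> (torus_proj x)) =
               (\<Sum>\<xi> \<in> frequencies E. a \<xi> * unit_character (x \<bullet> \<xi>))))"

definition nodal_set :: "(torus \<Rightarrow> real) \<Rightarrow> torus set" where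
  "nodal_set \<phi> = {p. \<phi> p = 0}"

text \<open>Derivatives at the end points of the interval are one-sided.  Injectivity
  need not be imposed: the total curvature and the length are both less than 1, so the
  curve and its projection to the torus are automatically simple.\<close>

definition regular_parametrization :: "(real \<Rightarrow> real ^ 2) \<Rightarrow> real \<Rightarrow> bool" where
  "regular_parametrization \<gamma> l \<longleftrightarrow>
     0 < l \<and> l < 1 \<and>
     (\<exists>\<gamma>' \<gamma>''.
        (\<forall>t \<in> {0..l}. (\<gamma> has_vector_derivative \<gamma>' t) (at t within {0..l})) \<and>
        (\<forall>t \<in> {0..l}. (\<gamma>' has_vector_derivative \<gamma>'' t) (at t within {0..l})) \<and>
        continuous_on {0..l} \<gamma>'' \<and>
        (\<forall>t \<in> {0..l}. norm (\<gamma>' t) = 1) \<and>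
        (\<exists>\<kappa>>0. (\<forall>t \<in> {0..l}. \<kappa> < norm (\<gamma>'' t) \<and> norm (\<gamma>'' t) < 2 * \<kappa>) \<and> 2 * \<kappa> * l < 1))"

text \<open>A curve in the torus is \<open>C\<^sup>2\<close> with arc-length parametrization iff it has
  such a lift to the plane, so regular arcs in the torus are described through their
  lifts.  The lift \<open>K\<close> of \<open>C\<close> is unique up to integer translations.\<close>

definition regular_arc_lift :: "torus set \<Rightarrow> (real ^ 2) set \<Rightarrow> bool" where
  "regular_arc_lift C K \<longleftrightarrow>
     (\<exists>\<gamma> l. regular_parametrization \<gamma> l \<and> K = \<gamma> ` {0..l} \<and> C = torus_proj ` K)"

text \<open>The line \<open>{x. u \<bullet> x = s}\<close>, where \<open>u\<close> is a unit normal, supports \<open>K\<close>.\<close>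

definition supporting_line :: "(real ^ 2) set \<Rightarrow> real ^ 2 \<Rightarrow> real \<Rightarrow> bool" where
  "supporting_line K u s \<longleftrightarrow>
     norm u = 1 \<and> (\<exists>x\<in>K. u \<bullet> x = s) \<and>
     ((\<forall>x\<in>K. u \<bullet> x \<le> s) \<or> (\<forall>x\<in>K. s \<le> u \<bullet> x))"

text \<open>The two parallel lines are required to be distinct, which forces \<open>K\<close> to lie
  between them.  For a regular arc the infimum is attained.\<close>

definition curve_width :: "(real ^ 2) set \<Rightarrow> real" where
  "curve_width K = Inf {setdist {x. u \<bullet> x = s} {x. u \<bullet> x = t} | u s t.
     s \<noteq> t \<and> supporting_line K u s \<and> supporting_line K u t}"

definition sums_of_two_squares :: "nat set" where
  "sums_of_two_squares = {E. E \<ge> 1 \<and> (\<exists>a b :: nat. E = a\<^sup>2 + b\<^sup>2)}"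

definition almost_all_sums_of_two_squares :: "(nat \<Rightarrow> bool) \<Rightarrow> bool" where
  "almost_all_sums_of_two_squares P \<longleftrightarrow>
     (\<lambda>N. real (card {E \<in> sums_of_two_squares. E \<le> N \<and> \<not> P E}) /
          real (card {E \<in> sums_of_two_squares. E \<le> N})) \<longlonglongrightarrow> 0"

end

theory Submission
  imports Defs "HOL-Library.Discrete_Functions" "HOL-Real_Asymp.Real_Asymp"
begin

text \<open>
  Write \<open>\<lambda> = sqrt E\<close>.  The proof separates arithmetic from analysis by means of the property that any two
  distinct frequencies of \<open>E\<close> are at distance at least \<open>d\<close>, the (1 - \<open>\<delta>\<close>)-th power of \<open>\<lambda>\<close>.

  Arithmetic: almost all sums of two squares have this property (\<open>almost_all_separated\<close>).
  Two lattice points \<open>(a, b)\<close>, \<open>(c, d)\<close> lie on the same circle about the origin iff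
  \<open>(a - c) (a + c) = (d - b) (d + b)\<close>, so close pairs correspond to solutions of \<open>x y = z w\<close> with small \<open>x\<close> and \<open>z\<close>.
  The estimate \<open>card_product_quadruples_le\<close> shows that these are rare by a power of \<open>N\<close>.  Applied without the
  closeness condition, the same estimate gives the second moment of the number of representations, and
  hence a lower bound of order \<open>N / log N\<close> for the number of sums of two squares.

  Analysis: let \<open>E\<close> have the property.  Packing shows that there are only \<open>M\<close> frequencies, with \<open>M\<close> at
  most a constant times the \<open>2 \<delta>\<close>-th power of \<open>\<lambda>\<close>.  Let the eigenfunction vanish on a regular arc of length
  \<open>l\<close> and curvature about \<open>\<kappa>\<close>, and divide it by the character with the largest coefficient.  Integrated along
  the arc, this term contributes the length, while every other term is an oscillatory integral whose
  frequency \<open>h\<close> has norm at least \<open>d\<close>; by \<open>oscillatory_integral_along_arc\<close>, on half of the arc it is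
  \<open>O(1 / d + 1 / sqrt (\<kappa> d))\<close>.  Hence \<open>l\<close> is \<open>O(M / d + M / sqrt (\<kappa> d))\<close>, which forces
  \<open>\<kappa> l\<^sup>2\<close> to be \<open>O(M\<^sup>2 / d)\<close> because \<open>\<kappa> l\<close> is bounded.  The width of the arc is
  at most \<open>2 \<kappa> l\<^sup>2\<close> (\<open>curve_width_le\<close>), so it is bounded by a constant times the (\<open>5 \<delta> - 1\<close>)-th power of \<open>\<lambda>\<close>.
\<close>

section \<open>Integer solutions of $x y = z w$\<close>

definition product_quadruples :: "nat \<Rightarrow> nat \<Rightarrow> (int \<times> int \<times> int \<times> int) set" where
  "product_quadruples R Y = {(x, y, z, w). x * y = z * w \<and> (x, z) \<noteq> (0, 0) \<and>
     \<bar>x\<bar> \<le> int R \<and> \<bar>z\<bar> \<le> int R \<and> \<bar>y\<bar> \<le> int Y \<and> \<bar>w\<bar> \<le> int Y}"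

text \<open>Take \<open>p\<close> to be the greatest common divisor of \<open>x\<close> and \<open>z\<close>.  After division by \<open>p\<close> the
  equation reads \<open>q y = r w\<close> with \<open>q\<close> and \<open>r\<close> coprime.  This form of the parametrisation also
  covers solutions with vanishing entries, so no case distinction on signs is needed below.\<close>

lemma four_number_lemma:
  fixes x y z w :: int
  assumes eq: "x * y = z * w" and nz: "(x, z) \<noteq> (0, 0)"
  obtains p q r s where "p \<ge> 1" "(q, r) \<noteq> (0, 0)"
    "x = p * q" "y = r * s" "z = p * r" "w = q * s"
proof -
  define p where "p = gcd x z"
  have p: "p > 0" using nz by (auto simp: p_def)
  define q where "q = x div p"
  define r where "r = z div p"
  have x: "x = p * q" and z: "z = p * r" by (auto simp: p_def q_def r_def)
  have cop: "coprime q r"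
    using nz unfolding q_def r_def p_def by (auto intro!: div_gcd_coprime)
  have qy: "q * y = r * w" using eq p unfolding x z by simp
  have "r dvd y"
    using cop qy by (metis coprime_commute coprime_dvd_mult_right_iff dvd_triv_left)
  have "\<exists>s. y = r * s \<and> w = q * s"
  proof (cases "r = 0")
    case True
    then have "is_unit q" "y = 0" using cop \<open>r dvd y\<close> by auto
    then show ?thesis using True by (metis dvd_def mult_zero_left one_dvd dvd_trans)
  next
    case False
    obtain s where "y = r * s" using \<open>r dvd y\<close> by auto
    then show ?thesis using qy False by (auto simp: ac_simps)
  qed
  then obtain s where "y = r * s" "w = q * s" by auto
  moreover have "(q, r) \<noteq> (0, 0)" using nz x z by auto
  ultimately show ?thesis using that[of p q r s] p x z by auto
qed

text \<open>Parametrise a solution by \<open>x = p q\<close>, \<open>z = p r\<close>, \<open>y = r s\<close>, \<open>w = q s\<close> and sort by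
  \<open>m = max \<bar>q\<bar> \<bar>r\<bar>\<close>: there are \<open>O(m)\<close> pairs \<open>(q, r)\<close>, at most \<open>R / m\<close> values of \<open>p\<close> and
  \<open>O(Y / m)\<close> values of \<open>s\<close>, hence \<open>O(R Y / m)\<close> solutions for each \<open>m \<le> R\<close>.  The hypothesis \<open>R \<le> Y\<close>
  keeps \<open>Y / m \<ge> 1\<close>, so that \<open>2 \<lfloor>Y / m\<rfloor> + 1 \<le> 3 Y / m\<close>.\<close>

lemma card_product_quadruples_le:
  assumes "R \<le> Y"
  shows "finite (product_quadruples R Y)"
    and "real (card (product_quadruples R Y)) \<le> 36 * real R * real Y * harm R"
proof -
  define shell where "shell m = {- int m, int m} \<times> {- int m..int m} \<union> {- int m..int m} \<times> {- int m, int m}" for m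
  define params where
    "params m = ({1..int (R div m)} \<times> {- int (Y div m)..int (Y div m)}) \<times> shell m" for m
  define prd where "prd = (\<lambda>((p, s), (q, r)). (p * q, r * s, p * r, q * s :: int))"
  have sub: "product_quadruples R Y \<subseteq> (\<Union>m\<in>{1..R}. prd ` params m)"
  proof
    fix v assume "v \<in> product_quadruples R Y"
    then obtain x y z w where v: "v = (x, y, z, w)" and eq: "x * y = z * w" "(x, z) \<noteq> (0, 0)"
      and bnd: "\<bar>x\<bar> \<le> int R" "\<bar>z\<bar> \<le> int R" "\<bar>y\<bar> \<le> int Y" "\<bar>w\<bar> \<le> int Y"
      by (auto simp: product_quadruples_def)
    obtain p q r s where pqrs: "p \<ge> 1" "(q, r) \<noteq> (0, 0)"
      "x = p * q" "y = r * s" "z = p * r" "w = q * s"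
      using four_number_lemma[OF eq] by metis
    define m where "m = nat (max \<bar>q\<bar> \<bar>r\<bar>)"
    have m: "m \<ge> 1" "int m = max \<bar>q\<bar> \<bar>r\<bar>" using pqrs(2) by (auto simp: m_def)
    have pm: "p * int m \<le> int R" using bnd(1,2) pqrs(1) unfolding pqrs m(2)
      by (auto simp: max_def abs_mult)
    have sm: "\<bar>s\<bar> * int m \<le> int Y" using bnd(3,4) unfolding pqrs m(2)
      by (auto simp: max_def abs_mult mult.commute)
    have p2: "p \<le> int (R div m)"
      using zdiv_mono1[OF pm, of "int m"] m(1) by (simp add: zdiv_int)
    have s2: "\<bar>s\<bar> \<le> int (Y div m)"
      using zdiv_mono1[OF sm, of "int m"] m(1) by (simp add: zdiv_int)
    have "m \<le> R" using pm pqrs(1) by (smt (verit) mult_le_cancel_right1 of_nat_0_le_iff of_nat_le_iff)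
    moreover have "(q, r) \<in> shell m" using m(2) by (auto simp: shell_def max_def split: if_splits)
    then have "((p, s), (q, r)) \<in> params m"
      using p2 s2 pqrs(1) by (auto simp: params_def)
    moreover have "v = prd ((p, s), (q, r))" by (simp add: prd_def v pqrs)
    ultimately show "v \<in> (\<Union>m\<in>{1..R}. prd ` params m)" using m(1) by auto
  qed
  have fin: "finite (params m)" for m by (simp add: params_def shell_def)
  show "finite (product_quadruples R Y)"
    by (rule finite_subset[OF sub]) (auto simp: fin)
  have shell: "card (shell m) \<le> 12 * m" if "m \<ge> 1" for m
  proof -
    have "card (shell m) \<le> 2 * (2 * m + 1) + (2 * m + 1) * 2"
      unfolding shell_def
      by (rule order.trans[OF card_Un_le]) (use that in \<open>auto simp: card_cartesian_product nat_add_distrib\<close>)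
    then show ?thesis using that by simp
  qed
  have params: "real (card (params m)) \<le> 36 * real R * real Y / real m" if "m \<in> {1..R}" for m
  proof -
    have m: "real m > 0" using that by simp
    have "card (params m) = (R div m) * (2 * (Y div m) + 1) * card (shell m)"
      by (simp add: params_def card_cartesian_product nat_add_distrib nat_mult_distrib)
    also have "real \<dots> \<le> real R / real m * (3 * (real Y / real m)) * (12 * real m)"
    proof -
      have "real (R div m) \<le> real R / real m" "real (Y div m) \<le> real Y / real m"
        by (rule of_nat_div_le_of_nat)+
      moreover have "1 \<le> real Y / real m" using that assms by simp
      moreover have "real (card (shell m)) \<le> 12 * real m" using shell[of m] that by simp
      ultimately show ?thesis
        unfolding of_nat_mult by (intro mult_mono) auto
    qed
    also have "\<dots> = 36 * real R * real Y / real m" using m by (simp add: field_simps)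
    finally show ?thesis by simp
  qed
  have "card (product_quadruples R Y) \<le> card (\<Union>m\<in>{1..R}. prd ` params m)"
    by (rule card_mono[OF _ sub]) (auto simp: fin)
  also have "\<dots> \<le> (\<Sum>m\<in>{1..R}. card (prd ` params m))"
    by (rule card_UN_le) simp
  also have "\<dots> \<le> (\<Sum>m\<in>{1..R}. card (params m))"
    by (intro sum_mono card_image_le fin)
  finally have "real (card (product_quadruples R Y)) \<le> (\<Sum>m\<in>{1..R}. real (card (params m)))"
    by (simp flip: of_nat_sum)
  also have "\<dots> \<le> (\<Sum>m\<in>{1..R}. 36 * real R * real Y / real m)"
    by (rule sum_mono) (rule params)
  also have "\<dots> = 36 * real R * real Y * harm R"
    by (simp add: harm_def sum_distrib_left divide_inverse)
  finally show "real (card (product_quadruples R Y)) \<le> 36 * real R * real Y * harm R" .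
qed

section \<open>Sums of two squares and close frequencies\<close>

text \<open>The Cauchy-Schwarz inequality for the sizes of the fibres of \<open>f\<close>.\<close>

lemma card_power2_le_image_times_pairs:
  assumes "finite A"
  shows "(card A)\<^sup>2 \<le> card (f ` A) * card {(p, q) \<in> A \<times> A. f p = f q}"
proof -
  define c where "c v = card {p \<in> A. f p = v}" for v
  have A: "card A = (\<Sum>v\<in>f ` A. c v)"
    unfolding c_def using sum.image_gen[OF assms, of "\<lambda>_. 1::nat" f] by simp
  have "{(p, q) \<in> A \<times> A. f p = f q} = (\<Union>v\<in>f ` A. {p \<in> A. f p = v} \<times> {p \<in> A. f p = v})"
    by auto
  also have "card \<dots> = (\<Sum>v\<in>f ` A. (c v)\<^sup>2)"
    using assms by (subst card_UN_disjoint) (auto simp: c_def card_cartesian_product power2_eq_square)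
  finally have B: "card {(p, q) \<in> A \<times> A. f p = f q} = (\<Sum>v\<in>f ` A. (c v)\<^sup>2)" .
  have "(\<Sum>v\<in>f ` A. real (c v))\<^sup>2 \<le> real (card (f ` A)) * (\<Sum>v\<in>f ` A. (real (c v))\<^sup>2)"
    using sum_squared_le_sum_of_squares[of "\<lambda>v. real (c v)" "f ` A"] assms by (simp add: mult.commute)
  then have "real ((card A)\<^sup>2) \<le> real (card (f ` A) * card {(p, q) \<in> A \<times> A. f p = f q})"
    unfolding A B by simp
  then show ?thesis by (simp only: of_nat_le_iff)
qed

lemma harm_le_ln: "1 \<le> n \<Longrightarrow> (harm n :: real) \<le> 1 + ln (real n)"
  using decseqD[OF decseq_harm_diff_ln, of 0 "n - 1"] by (simp add: harm_expand)

text \<open>The second moment method.  The map \<open>(a, b) \<mapsto> a\<^sup>2 + b\<^sup>2\<close> sends a box with about \<open>N\<close>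
  points into the sums of two squares up to \<open>N\<close>, and two points \<open>(a, b)\<close>, \<open>(c, d)\<close> have the same image iff
  \<open>(a - c) (a + c) = (d - b) (d + b)\<close>.  The count of solutions of \<open>x y = z w\<close> therefore bounds
  the colliding pairs by \<open>O(N log N)\<close>.  The resulting lower bound \<open>N / log N\<close> falls short of
  the true order \<open>N / sqrt (log N)\<close>, but the exceptional set is smaller by a power of \<open>N\<close>.\<close>

lemma card_sums_of_two_squares_ge:
  assumes "N \<ge> 2"
  shows "real N / (584 * (1 + ln (real N))) \<le> real (card {E \<in> sums_of_two_squares. E \<le> N})"
proof -
  define k where "k = floor_sqrt (N div 2)"
  have k1: "k \<ge> 1" using assms unfolding k_def by (metis Suc_le_eq div_greater_zero_iff floor_sqrt_greater_zero_iff One_nat_def zero_less_numeral)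
  have k2: "2 * k\<^sup>2 \<le> N" using floor_sqrt_power2_le[of "N div 2"] unfolding k_def by linarith
  have "N div 2 < (Suc k)\<^sup>2" unfolding k_def by (rule Suc_floor_sqrt_power2_gt)
  also have "\<dots> \<le> (2 * k)\<^sup>2" using k1 by (intro power_mono) auto
  finally have k3: "N \<le> 8 * k\<^sup>2" by (simp add: power_mult_distrib)
  define A where "A = {1..k} \<times> {1..k}"
  define f where "f = (\<lambda>(a, b). a\<^sup>2 + b\<^sup>2 :: nat)"
  define D where "D = {(p, q) \<in> A \<times> A. f p = f q}"
  define B where "B = card {E \<in> sums_of_two_squares. E \<le> N}"
  have finA: "finite A" by (simp add: A_def)
  have imB: "card (f ` A) \<le> B" unfolding B_def
  proof (rule card_mono)
    show "finite {E \<in> sums_of_two_squares. E \<le> N}" by (rule finite_subset[of _ "{..N}"]) auto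
    have "a\<^sup>2 + b\<^sup>2 \<le> N" if "a \<le> k" "b \<le> k" for a b
      using power_mono[OF that(1) le0, of 2] power_mono[OF that(2) le0, of 2] k2 by linarith
    then show "f ` A \<subseteq> {E \<in> sums_of_two_squares. E \<le> N}"
      by (auto simp: f_def A_def sums_of_two_squares_def Suc_le_eq)
  qed
  have D: "real (card D) \<le> real (k\<^sup>2) + 72 * real (k\<^sup>2) * harm k"
  proof -
    \<comment> \<open>Pairs off the diagonal have a nonzero difference, as the solution count demands.\<close>
    define T where "T = (\<lambda>((a, b), (c, d)). (int a - int c, int a + int c, int d - int b, int d + int b))"
    have "card (D - Id) = card (T ` (D - Id))"
      by (intro card_image[symmetric] inj_onI) (auto simp: T_def)
    also have "\<dots> \<le> card (product_quadruples k (2 * k))"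
    proof (rule card_mono)
      show "finite (product_quadruples k (2 * k))" by (rule card_product_quadruples_le) simp
      have "(int a - int c) * (int a + int c) = (int d - int b) * (int d + int b)"
        if "a\<^sup>2 + b\<^sup>2 = c\<^sup>2 + d\<^sup>2" for a b c d
        using arg_cong[OF that, of int] by (simp add: algebra_simps power2_eq_square)
      then show "T ` (D - Id) \<subseteq> product_quadruples k (2 * k)"
        by (force simp: T_def D_def A_def f_def product_quadruples_def)
    qed
    finally have "real (card (D - Id)) \<le> 72 * real (k\<^sup>2) * harm k"
      using card_product_quadruples_le(2)[of k "2 * k"] by (simp add: power2_eq_square algebra_simps)
    moreover have "card (D \<inter> Id) \<le> k\<^sup>2"
    proof -
      have "D \<inter> Id \<subseteq> (\<lambda>p. (p, p)) ` A" by (auto simp: D_def)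
      then have "card (D \<inter> Id) \<le> card A" using surj_card_le finA by metis
      then show ?thesis by (simp add: A_def power2_eq_square)
    qed
    moreover have "card D = card (D - Id) + card (D \<inter> Id)"
    proof -
      have "finite D" using finA by (auto simp: D_def intro: finite_subset[of _ "A \<times> A"])
      then show ?thesis by (metis Int_Diff_Un Int_Diff_disjoint card_Un_disjoint finite_Diff finite_Int add.commute)
    qed
    ultimately show ?thesis by (smt (verit) of_nat_add of_nat_le_iff)
  qed
  have harm: "1 \<le> (harm k :: real)" "(harm k :: real) \<le> 1 + ln (real N)"
  proof -
    show "1 \<le> (harm k :: real)" using harm_mono[OF k1] by (simp add: harm_expand)
    have "k \<le> N" using k2 k1 by (metis le_trans le_add1 mult_2 power2_nat_le_imp_le self_le_power zero_less_numeral le_add2)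
    then have "ln (real k) \<le> ln (real N)" using k1 by simp
    then show "(harm k :: real) \<le> 1 + ln (real N)" using harm_le_ln[OF k1] by simp
  qed
  have "real ((k\<^sup>2)\<^sup>2) \<le> real (B * card D)"
  proof -
    have "(k\<^sup>2)\<^sup>2 \<le> card (f ` A) * card D"
      using card_power2_le_image_times_pairs[OF finA, of f] unfolding D_def
      by (simp add: A_def power2_eq_square)
    also have "\<dots> \<le> B * card D" using imB by simp
    finally show ?thesis by (simp only: of_nat_le_iff)
  qed
  also have "\<dots> \<le> real B * (73 * real (k\<^sup>2) * (1 + ln (real N)))"
  proof -
    have "real (k\<^sup>2) * 1 \<le> real (k\<^sup>2) * harm k" using harm by (intro mult_left_mono) auto
    moreover have "real (k\<^sup>2) * harm k \<le> real (k\<^sup>2) * (1 + ln (real N))" using harm by (intro mult_left_mono) auto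
    ultimately have "real (card D) \<le> 73 * real (k\<^sup>2) * (1 + ln (real N))" using D by simp
    then show ?thesis by (simp add: mult_left_mono)
  qed
  finally have "real (k\<^sup>2) * real (k\<^sup>2) \<le> real (k\<^sup>2) * (73 * real B * (1 + ln (real N)))"
    by (simp add: power2_eq_square algebra_simps)
  then have "real (k\<^sup>2) \<le> 73 * real B * (1 + ln (real N))" using k1 by (subst (asm) mult_le_cancel_left_pos) auto
  moreover have "real N \<le> 8 * real (k\<^sup>2)" using k3 by (metis of_nat_le_iff of_nat_mult of_nat_numeral)
  ultimately have "real N \<le> real B * (584 * (1 + ln (real N)))" by (simp add: algebra_simps)
  moreover have "584 * (1 + ln (real N)) > 0" using assms by (smt (verit) ln_ge_zero of_nat_1 of_nat_mono one_le_numeral order.trans)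
  ultimately show ?thesis unfolding B_def by (simp add: pos_divide_le_eq)
qed

definition separated :: "real \<Rightarrow> nat \<Rightarrow> bool" where
  "separated d E \<longleftrightarrow> (\<forall>\<xi> \<in> frequencies E. \<forall>\<eta> \<in> frequencies E. \<xi> \<noteq> \<eta> \<longrightarrow> d \<le> norm (\<xi> - \<eta>))"

text \<open>Two distinct frequencies \<open>(a, b)\<close>, \<open>(c, d)\<close> of \<open>E\<close> again solve
  \<open>(a - c) (a + c) = (d - b) (d + b)\<close>.  If they are close, then the differences are at
  most \<open>N\<close> to the power \<open>(1 - \<delta>) / 2\<close> whereas the sums are at most \<open>2 sqrt N\<close>, and the solution
  determines \<open>E\<close>.  So there are no more exceptional \<open>E\<close> than such solutions.\<close>

lemma card_not_separated_le:
  fixes \<delta> :: real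
  assumes \<delta>: "0 < \<delta>" "\<delta> \<le> 1" and N: "N \<ge> 1"
  shows "real (card {E \<in> sums_of_two_squares. E \<le> N \<and> \<not> separated (sqrt (real E) powr (1 - \<delta>)) E})
    \<le> 108 * (real N powr (1 - \<delta> / 2) * (1 + ln (real N)))"
proof -
  define \<rho> where "\<rho> = sqrt (real N) powr (1 - \<delta>)"
  define R where "R = nat \<lfloor>\<rho>\<rfloor>"
  define Y where "Y = nat \<lfloor>2 * sqrt (real N)\<rfloor>"
  have sN: "sqrt (real N) \<ge> 1" using N by simp
  have \<rho>1: "1 \<le> \<rho>" unfolding \<rho>_def using sN \<delta> by (simp add: ge_one_powr_ge_zero)
  have \<rho>N: "\<rho> \<le> sqrt (real N)" unfolding \<rho>_def
    using powr_mono[of "1 - \<delta>" 1 "sqrt (real N)"] sN \<delta> by simp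
  have R: "R \<ge> 1" "real R \<le> \<rho>" using \<rho>1 by (auto simp: R_def le_nat_iff)
  have Y: "real Y \<le> 2 * sqrt (real N)" by (simp add: Y_def)
  have RY: "R \<le> Y" unfolding R_def Y_def using \<rho>N sN by (intro nat_mono floor_mono) linarith
  have coord: "\<exists>n. \<xi> $ i = of_int n \<and> \<bar>of_int n\<bar> \<le> sqrt (real E)" if "\<xi> \<in> frequencies E" for \<xi> i E
  proof -
    have "\<xi> $ i \<in> \<int>" "norm \<xi> = sqrt (real E)"
      using that by (auto simp: frequencies_def integer_lattice_def real_sqrt_unique)
    then show ?thesis using component_le_norm_cart[of \<xi> i] by (auto elim!: Ints_cases)
  qed
  have intle: "\<bar>j\<bar> \<le> int (nat \<lfloor>r\<rfloor>)" if "\<bar>of_int j\<bar> \<le> r" for j and r :: real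
  proof -
    have "\<bar>j\<bar> \<le> \<lfloor>r\<rfloor>" using that by (simp add: le_floor_iff)
    then show ?thesis by linarith
  qed
  \<comment> \<open>Recovers \<open>E\<close> from a solution: \<open>a\<close> is half of \<open>x + y\<close>, and \<open>b\<close> is half of \<open>w - z\<close>.\<close>
  let ?g = "\<lambda>(x, y, z, w). nat (((x + y) div 2)\<^sup>2 + ((w - z) div 2)\<^sup>2)"
  let ?S = "{E \<in> sums_of_two_squares. E \<le> N \<and> \<not> separated (sqrt (real E) powr (1 - \<delta>)) E}"
  have "?S \<subseteq> ?g ` product_quadruples R Y"
  proof
    fix E assume "E \<in> ?S"
    then obtain \<xi> \<eta> where EN: "E \<le> N" and fr: "\<xi> \<in> frequencies E" "\<eta> \<in> frequencies E" and ne: "\<xi> \<noteq> \<eta>"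
      and close: "norm (\<xi> - \<eta>) < sqrt (real E) powr (1 - \<delta>)"
      by (auto simp: separated_def not_le)
    have sE: "sqrt (real E) \<le> sqrt (real N)" using EN by simp
    have close': "norm (\<xi> - \<eta>) \<le> \<rho>"
      using close powr_mono2[of "1 - \<delta>" "sqrt (real E)" "sqrt (real N)"] sE \<delta> by (simp add: \<rho>_def)
    obtain a b c d where ab: "\<xi> $ 1 = of_int a" "\<xi> $ 2 = of_int b" "\<eta> $ 1 = of_int c" "\<eta> $ 2 = of_int d"
      and ab': "\<bar>of_int a\<bar> \<le> sqrt (real E)" "\<bar>of_int b\<bar> \<le> sqrt (real E)"
        "\<bar>of_int c\<bar> \<le> sqrt (real E)" "\<bar>of_int d\<bar> \<le> sqrt (real E)"
      using coord[OF fr(1), of 1] coord[OF fr(1), of 2] coord[OF fr(2), of 1] coord[OF fr(2), of 2] by metis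
    have nsq: "(norm v)\<^sup>2 = (v $ 1)\<^sup>2 + (v $ 2)\<^sup>2" for v :: "real ^ 2"
      unfolding power2_norm_eq_inner by (simp add: inner_vec_def sum_2 power2_eq_square)
    have "real_of_int (a\<^sup>2 + b\<^sup>2) = real_of_int (int E)" "real_of_int (c\<^sup>2 + d\<^sup>2) = real_of_int (int E)"
      using fr nsq[of \<xi>] nsq[of \<eta>] ab by (auto simp: frequencies_def)
    then have E: "a\<^sup>2 + b\<^sup>2 = int E" "c\<^sup>2 + d\<^sup>2 = int E" by (simp_all only: of_int_eq_iff)
    have "\<bar>real_of_int (a - c)\<bar> \<le> \<rho>" "\<bar>real_of_int (d - b)\<bar> \<le> \<rho>"
      using component_le_norm_cart[of "\<xi> - \<eta>" 1] component_le_norm_cart[of "\<xi> - \<eta>" 2] close' ab by auto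
    moreover have "\<bar>real_of_int (a + c)\<bar> \<le> 2 * sqrt (real N)" "\<bar>real_of_int (d + b)\<bar> \<le> 2 * sqrt (real N)"
      using ab' sE unfolding of_int_add by linarith+
    moreover have "(a - c) * (a + c) = (d - b) * (d + b)"
      using E by (simp add: algebra_simps power2_eq_square)
    moreover have "(a - c, d - b) \<noteq> (0, 0)" using ne ab by (auto simp: vec_eq_iff forall_2)
    ultimately have "(a - c, a + c, d - b, d + b) \<in> product_quadruples R Y"
      unfolding product_quadruples_def R_def Y_def using intle by blast
    moreover have "?g (a - c, a + c, d - b, d + b) = E" using E by simp
    ultimately show "E \<in> ?g ` product_quadruples R Y" by force
  qed
  then have "card ?S \<le> card (product_quadruples R Y)"
    by (rule surj_card_le[OF card_product_quadruples_le(1)[OF RY]])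
  then have "real (card ?S) \<le> 36 * real R * real Y * harm R"
    using card_product_quadruples_le(2)[OF RY] by simp
  also have "\<dots> \<le> 36 * \<rho> * (3 * sqrt (real N)) * (1 + ln (real N))"
  proof (intro mult_mono)
    have "sqrt (real N) * 1 \<le> sqrt (real N) * sqrt (real N)" using sN by (intro mult_left_mono) auto
    then have "real R \<le> real N" using R \<rho>N by simp
    then have "ln (real R) \<le> ln (real N)" using R by simp
    then show "harm R \<le> 1 + ln (real N)" using harm_le_ln[OF R(1)] by linarith
  qed (use R Y \<rho>1 sN in \<open>auto simp: harm_nonneg\<close>)
  also have "\<rho> * sqrt (real N) = real N powr (1 - \<delta> / 2)"
  proof -
    have "\<rho> = real N powr ((1 - \<delta>) / 2)" "sqrt (real N) = real N powr (1 / 2)"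
      unfolding \<rho>_def by (simp_all add: powr_powr flip: powr_half_sqrt)
    then show ?thesis by (simp add: field_simps flip: powr_add)
  qed
  then have "36 * \<rho> * (3 * sqrt (real N)) * (1 + ln (real N)) = 108 * (real N powr (1 - \<delta> / 2) * (1 + ln (real N)))"
    by simp
  finally show ?thesis .
qed

section \<open>Oscillatory integrals\<close>

lemma norm_unit_character [simp]: "norm (unit_character t) = 1"
proof -
  have "unit_character t = cis (2 * pi * t)"
    unfolding unit_character_def cis_conv_exp by (simp add: mult_ac)
  then show ?thesis by simp
qed

lemma unit_character_add: "unit_character (s + t) = unit_character s * unit_character t"
  by (simp add: unit_character_def algebra_simps exp_add)

lemma has_vector_derivative_unit_character:
  assumes "(f has_vector_derivative f') (at t within S)"
  shows "((\<lambda>t. unit_character (f t)) has_vector_derivative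
    (2 * of_real pi * \<i> * of_real f') * unit_character (f t)) (at t within S)"
proof -
  have "(unit_character has_vector_derivative (2 * of_real pi * \<i>) * unit_character x) (at x)" for x
  proof -
    have "((\<lambda>z. exp (2 * of_real pi * \<i> * z)) has_field_derivative
        exp (2 * of_real pi * \<i> * of_real x) * (2 * of_real pi * \<i>)) (at (of_real x))"
      by (rule DERIV_chain2[where f = exp]) (rule DERIV_exp, rule DERIV_cmult_Id)
    from has_vector_derivative_real_field[OF this] show ?thesis
      by (simp only: unit_character_def[abs_def] mult.commute)
  qed
  then have "(unit_character has_vector_derivative (2 * of_real pi * \<i>) * unit_character (f t)) (at (f t) within f ` S)"
    by (rule has_vector_derivative_at_within)
  from vector_diff_chain_within[OF assms this] show ?thesis
    by (simp only: o_def scaleR_conv_of_real of_real_mult of_real_numeral mult_ac)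
qed

text \<open>Integration by parts in a form without products: \<open>F\<close> is an approximate primitive of the
  oscillating function \<open>w\<close>, and the error is dominated by the derivative of a function \<open>G\<close> of
  small total variation.\<close>

lemma norm_integral_le_by_comparison:
  fixes w F :: "real \<Rightarrow> complex" and G :: "real \<Rightarrow> real"
  assumes "a \<le> b" "continuous_on {a..b} w"
    and F: "\<And>t. t \<in> {a..b} \<Longrightarrow> (F has_vector_derivative F' t) (at t within {a..b})"
    and G: "\<And>t. t \<in> {a..b} \<Longrightarrow> (G has_vector_derivative G' t) (at t within {a..b})"
    and le: "\<And>t. t \<in> {a..b} \<Longrightarrow> norm (w t - F' t) \<le> G' t"
  shows "norm (integral {a..b} w) \<le> norm (F b - F a) + (G b - G a)"
proof -
  have iF: "(F' has_integral (F b - F a)) {a..b}"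
    by (rule fundamental_theorem_of_calculus) (use assms in auto)
  have iG: "(G' has_integral (G b - G a)) {a..b}"
    by (rule fundamental_theorem_of_calculus) (use assms in auto)
  have iw: "w integrable_on {a..b}"
    by (rule integrable_continuous_real) fact
  have "((\<lambda>t. w t - F' t) has_integral (integral {a..b} w - (F b - F a))) {a..b}"
    by (rule has_integral_diff[OF integrable_integral[OF iw] iF])
  moreover from this have "norm (integral {a..b} (\<lambda>t. w t - F' t)) \<le> integral {a..b} G'"
    using iG le by (intro integral_norm_bound_integral) (auto simp: has_integral_integrable)
  ultimately have "norm (integral {a..b} w - (F b - F a)) \<le> G b - G a"
    using iG by (simp only: integral_unique)
  then show ?thesis
    using norm_triangle_sub[of "integral {a..b} w" "F b - F a"] by linarith
qed

text \<open>Where the phase derivative \<open>g\<close> stays away from zero, \<open>unit_character (f t) / (2 pi i g)\<close> is a small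
  approximate primitive: its derivative misses the integrand only by a term of size \<open>\<bar>g'\<bar> / g\<^sup>2\<close>.\<close>

lemma first_derivative_test:
  fixes f g g' :: "real \<Rightarrow> real"
  assumes ab: "a \<le> b"
    and f: "\<And>t. t \<in> {a..b} \<Longrightarrow> (f has_vector_derivative g t) (at t within {a..b})"
    and g: "\<And>t. t \<in> {a..b} \<Longrightarrow> (g has_vector_derivative g' t) (at t within {a..b})"
    and L: "L > 0" "\<And>t. t \<in> {a..b} \<Longrightarrow> L \<le> \<bar>g t\<bar>"
    and B: "\<And>t. t \<in> {a..b} \<Longrightarrow> \<bar>g' t\<bar> \<le> B"
  shows "norm (integral {a..b} (\<lambda>t. unit_character (f t))) \<le> (2 + B * (b - a) / L) / (2 * pi * L)"
proof -
  define F where "F t = of_real (1 / (2 * pi * g t)) * (- \<i>) * unit_character (f t)" for t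
  define F' where "F' t = unit_character (f t) + of_real (g' t / (2 * pi * (g t)\<^sup>2)) * \<i> * unit_character (f t)" for t
  have cont: "continuous_on {a..b} (\<lambda>t. unit_character (f t))"
    by (rule continuous_on_vector_derivative) (rule has_vector_derivative_unit_character, rule f)
  have F: "(F has_vector_derivative F' t) (at t within {a..b})" if "t \<in> {a..b}" for t
  proof -
    have gt: "g t \<noteq> 0" using L(1) L(2)[OF that] by auto
    have "((\<lambda>t. 1 / (2 * pi * g t)) has_field_derivative - g' t / (2 * pi * (g t)\<^sup>2)) (at t within {a..b})"
      using g[OF that] gt unfolding has_real_derivative_iff_has_vector_derivative[symmetric]
      by (auto intro!: derivative_eq_intros simp: field_simps power2_eq_square)
    from has_vector_derivative_mult[OF has_vector_derivative_mult[OF has_vector_derivative_of_real[OF this] has_vector_derivative_const[of "- \<i>"]]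
        has_vector_derivative_unit_character[OF f[OF that]]]
    show ?thesis unfolding F_def
      by (rule has_vector_derivative_eq_rhs) (use gt in \<open>simp add: F'_def field_simps\<close>)
  qed
  have nF: "norm (F t) \<le> 1 / (2 * pi * L)" if "t \<in> {a..b}" for t
    using L(1) L(2)[OF that] by (simp add: F_def norm_mult norm_divide abs_mult frac_le mult_left_mono)
  have "norm (integral {a..b} (\<lambda>t. unit_character (f t)))
      \<le> norm (F b - F a) + (B / (2 * pi * L\<^sup>2) * b - B / (2 * pi * L\<^sup>2) * a)"
  proof (rule norm_integral_le_by_comparison[OF ab cont F])
    fix t assume t: "t \<in> {a..b}"
    show "((\<lambda>t. B / (2 * pi * L\<^sup>2) * t) has_vector_derivative B / (2 * pi * L\<^sup>2)) (at t within {a..b})"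
      unfolding has_real_derivative_iff_has_vector_derivative[symmetric]
      by (auto intro!: derivative_eq_intros)
    have "L\<^sup>2 \<le> (g t)\<^sup>2" using L(1) L(2)[OF t] by (metis abs_le_square_iff abs_of_pos)
    then have "\<bar>g' t\<bar> / (2 * pi * (g t)\<^sup>2) \<le> B / (2 * pi * L\<^sup>2)"
      using B[OF t] L(1) by (intro frac_le) auto
    then show "norm (unit_character (f t) - F' t) \<le> B / (2 * pi * L\<^sup>2)"
      by (simp add: F'_def norm_mult norm_divide norm_power abs_mult)
  qed auto
  also have "norm (F b - F a) \<le> 1 / (2 * pi * L) + 1 / (2 * pi * L)"
    using norm_triangle_ineq4[of "F b" "F a"] nF[of a] nF[of b] ab
    by (meson add_mono atLeastAtMost_iff order.refl order.trans)
  finally show ?thesis using L(1) by (simp add: field_simps power2_eq_square)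
qed

lemma has_vector_derivative_arctan_rescaled:
  fixes g :: "real \<Rightarrow> real"
  assumes "(g has_vector_derivative g') (at t within S)"
  shows "((\<lambda>t. 2 * (s * (arctan (g t / c) / c))) has_vector_derivative
    2 * (s * (inverse (1 + (g t / c)\<^sup>2) * (g' / c) / c))) (at t within S)"
proof -
  have g: "(g has_field_derivative g') (at t within S)"
    using assms by (simp add: has_real_derivative_iff_has_vector_derivative)
  have "((\<lambda>t. arctan (g t / c)) has_field_derivative inverse (1 + (g t / c)\<^sup>2) * (g' / c)) (at t within S)"
    by (rule DERIV_chain2[where f = arctan and g = "\<lambda>t. g t / c", OF DERIV_arctan DERIV_cdivide]) (rule g)
  then show ?thesis
    unfolding has_real_derivative_iff_has_vector_derivative[symmetric]
    by - (rule DERIV_cmult, rule DERIV_cmult, rule DERIV_cdivide)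
qed

text \<open>The van der Corput estimate.  The usual proof treats separately the interval on which the
  phase derivative \<open>g\<close> is smaller than \<open>sqrt \<mu>\<close>.  Replacing \<open>1 / g\<close> in the approximate primitive by
  its regularisation \<open>g / (\<mu> + g\<^sup>2)\<close> avoids this: the error is then at most
  \<open>2 \<bar>g'\<bar> / (\<mu> + g\<^sup>2)\<close>, the derivative of a multiple of \<open>arctan (g / sqrt \<mu>) / sqrt \<mu>\<close>, because \<open>\<mu> \<le> \<bar>g'\<bar>\<close>.
  The number \<open>s\<close> is the constant sign of \<open>g'\<close>.\<close>

lemma second_derivative_test:
  fixes f g g' :: "real \<Rightarrow> real"
  assumes ab: "a \<le> b"
    and f: "\<And>t. t \<in> {a..b} \<Longrightarrow> (f has_vector_derivative g t) (at t within {a..b})"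
    and g: "\<And>t. t \<in> {a..b} \<Longrightarrow> (g has_vector_derivative g' t) (at t within {a..b})"
    and s: "\<bar>s\<bar> = 1" and \<mu>: "\<mu> > 0" "\<And>t. t \<in> {a..b} \<Longrightarrow> \<mu> \<le> s * g' t"
  shows "norm (integral {a..b} (\<lambda>t. unit_character (f t))) \<le> 7 / sqrt \<mu>"
proof -
  define H where "H t = 1 / (2 * pi) * (g t / (\<mu> + (g t)\<^sup>2))" for t
  define H' where "H' t = 1 / (2 * pi) * (g' t * (\<mu> - (g t)\<^sup>2) / (\<mu> + (g t)\<^sup>2)\<^sup>2)" for t
  define F where "F t = of_real (H t) * (- \<i>) * unit_character (f t)" for t
  define F' where "F' t = of_real ((g t)\<^sup>2 / (\<mu> + (g t)\<^sup>2)) * unit_character (f t) - of_real (H' t) * \<i> * unit_character (f t)" for t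
  define G where "G t = 2 * (s * (arctan (g t / sqrt \<mu>) / sqrt \<mu>))" for t
  define G' where "G' t = 2 * (s * g' t / (\<mu> + (g t)\<^sup>2))" for t
  have pos: "\<mu> + (g t)\<^sup>2 > 0" for t using \<mu>(1) by (simp add: add_pos_nonneg)
  have cont: "continuous_on {a..b} (\<lambda>t. unit_character (f t))"
    by (rule continuous_on_vector_derivative) (rule has_vector_derivative_unit_character, rule f)
  have F: "(F has_vector_derivative F' t) (at t within {a..b})" if "t \<in> {a..b}" for t
  proof -
    have "((\<lambda>t. g t / (\<mu> + (g t)\<^sup>2)) has_field_derivative
        (g' t * (\<mu> + (g t)\<^sup>2) - g t * (2 * g t * g' t)) / ((\<mu> + (g t)\<^sup>2) * (\<mu> + (g t)\<^sup>2))) (at t within {a..b})"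
      using g[OF that] pos[of t] unfolding has_real_derivative_iff_has_vector_derivative[symmetric]
      by (auto intro!: derivative_eq_intros)
    also have "g' t * (\<mu> + (g t)\<^sup>2) - g t * (2 * g t * g' t) = g' t * (\<mu> - (g t)\<^sup>2)"
      by (simp add: algebra_simps power2_eq_square)
    finally have "(H has_field_derivative H' t) (at t within {a..b})"
      unfolding H_def H'_def power2_eq_square[of "\<mu> + (g t)\<^sup>2"] by (rule DERIV_cmult)
    from has_vector_derivative_mult[OF has_vector_derivative_mult[OF has_vector_derivative_of_real[OF this] has_vector_derivative_const[of "- \<i>"]]
        has_vector_derivative_unit_character[OF f[OF that]]]
    have "(F has_vector_derivative
       (of_real (2 * pi * (g t * H t)) * unit_character (f t) - of_real (H' t) * \<i> * unit_character (f t))) (at t within {a..b})"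
      unfolding F_def by (rule has_vector_derivative_eq_rhs) (simp add: algebra_simps)
    moreover have "2 * pi * (g t * H t) = (g t)\<^sup>2 / (\<mu> + (g t)\<^sup>2)"
      by (simp add: H_def power2_eq_square)
    ultimately show ?thesis by (simp only: F'_def)
  qed
  have G: "(G has_vector_derivative G' t) (at t within {a..b})" if "t \<in> {a..b}" for t
  proof -
    have "1 + (g t / sqrt \<mu>)\<^sup>2 = (\<mu> + (g t)\<^sup>2) / \<mu>"
      using \<mu>(1) by (simp add: power_divide add_divide_distrib)
    then have "2 * (s * (inverse (1 + (g t / sqrt \<mu>)\<^sup>2) * (g' t / sqrt \<mu>) / sqrt \<mu>)) =
        2 * (s * (g' t * (\<mu> / (\<mu> + (g t)\<^sup>2)) / (sqrt \<mu> * sqrt \<mu>)))"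
      by (simp add: mult.assoc mult.commute[of "g' t" \<mu>])
    also have "\<dots> = G' t" using \<mu>(1) by (simp add: G'_def)
    finally have "G' t = 2 * (s * (inverse (1 + (g t / sqrt \<mu>)\<^sup>2) * (g' t / sqrt \<mu>) / sqrt \<mu>))" ..
    then show ?thesis
      using has_vector_derivative_arctan_rescaled[OF g[OF that], of s "sqrt \<mu>"] by (simp only: G_def[abs_def])
  qed
  have rest: "norm (unit_character (f t) - F' t) \<le> G' t" if t: "t \<in> {a..b}" for t
  proof -
    have g': "\<bar>g' t\<bar> = s * g' t"
      using \<mu>(1) \<mu>(2)[OF t] s by (cases "s = 1") (auto simp: abs_if split: if_splits)
    have split: "unit_character (f t) - F' t =
      of_real (\<mu> / (\<mu> + (g t)\<^sup>2)) * unit_character (f t) + of_real (H' t) * \<i> * unit_character (f t)"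
    proof -
      have "\<mu> / (\<mu> + (g t)\<^sup>2) = 1 - (g t)\<^sup>2 / (\<mu> + (g t)\<^sup>2)"
        using pos[of t] by (simp add: field_simps)
      then have "complex_of_real (\<mu> / (\<mu> + (g t)\<^sup>2)) = 1 - of_real ((g t)\<^sup>2 / (\<mu> + (g t)\<^sup>2))"
        by (simp only: of_real_diff of_real_1)
      then show ?thesis by (simp only: F'_def) (simp only: algebra_simps mult_1_left mult_1_right)
    qed
    have "norm (unit_character (f t) - F' t) \<le> \<bar>\<mu> / (\<mu> + (g t)\<^sup>2)\<bar> + \<bar>H' t\<bar>"
      unfolding split by (rule norm_triangle_le) (simp add: norm_mult del: of_real_divide)
    also have "\<bar>\<mu> / (\<mu> + (g t)\<^sup>2)\<bar> \<le> s * g' t / (\<mu> + (g t)\<^sup>2)"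
      using \<mu>(1) \<mu>(2)[OF t] pos[of t] by (simp add: divide_right_mono)
    also have "\<bar>H' t\<bar> \<le> s * g' t / (\<mu> + (g t)\<^sup>2)"
    proof -
      have "\<bar>\<mu> - (g t)\<^sup>2\<bar> \<le> \<mu> + (g t)\<^sup>2" using \<mu>(1) by (simp add: abs_le_iff)
      then have "\<bar>g' t\<bar> * \<bar>\<mu> - (g t)\<^sup>2\<bar> / (\<mu> + (g t)\<^sup>2)\<^sup>2 \<le> \<bar>g' t\<bar> * (\<mu> + (g t)\<^sup>2) / (\<mu> + (g t)\<^sup>2)\<^sup>2"
        by (intro divide_right_mono mult_left_mono) auto
      also have "\<dots> = s * g' t / (\<mu> + (g t)\<^sup>2)"
        using pos[of t] g' by (simp add: power2_eq_square)
      finally have *: "\<bar>g' t * (\<mu> - (g t)\<^sup>2) / (\<mu> + (g t)\<^sup>2)\<^sup>2\<bar> \<le> s * g' t / (\<mu> + (g t)\<^sup>2)"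
        by (simp add: abs_mult)
      have "1 / (2 * pi) \<le> 1" using pi_gt3 by simp
      then have "\<bar>H' t\<bar> \<le> 1 * \<bar>g' t * (\<mu> - (g t)\<^sup>2) / (\<mu> + (g t)\<^sup>2)\<^sup>2\<bar>"
        unfolding H'_def abs_mult by (intro mult_right_mono) auto
      then show ?thesis using * by simp
    qed
    finally show ?thesis by (simp add: G'_def)
  qed
  have I: "norm (integral {a..b} (\<lambda>t. unit_character (f t))) \<le> norm (F b - F a) + (G b - G a)"
    by (rule norm_integral_le_by_comparison[OF ab cont F G rest])
  have nF: "norm (F t) \<le> (1 / 12) / sqrt \<mu>" for t
  proof -
    have "2 * (sqrt \<mu> * \<bar>g t\<bar>) \<le> \<mu> + (g t)\<^sup>2"
      using sum_squares_bound[of "sqrt \<mu>" "\<bar>g t\<bar>"] \<mu>(1) by simp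
    then have "\<bar>g t\<bar> / (\<mu> + (g t)\<^sup>2) \<le> 1 / (2 * sqrt \<mu>)"
      using \<mu>(1) pos[of t] by (simp add: field_simps)
    then have "1 / (2 * pi) * (\<bar>g t\<bar> / (\<mu> + (g t)\<^sup>2)) \<le> 1 / 6 * (1 / (2 * sqrt \<mu>))"
      using pi_gt3 pos[of t] by (intro mult_mono) (auto simp: field_simps)
    then show ?thesis using pos[of t] by (simp add: F_def H_def norm_mult norm_divide abs_mult flip: of_real_power of_real_add)
  qed
  have "G b - G a \<le> 2 * pi / sqrt \<mu>"
  proof -
    have "\<bar>arctan x - arctan y\<bar> \<le> pi" for x y
      using arctan_bounded[of x] arctan_bounded[of y] by linarith
    moreover have "s * x \<le> \<bar>x\<bar>" for x
      using s abs_ge_self[of "s * x"] by (simp add: abs_mult)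
    ultimately have "s * (arctan (g b / sqrt \<mu>) - arctan (g a / sqrt \<mu>)) \<le> pi"
      by (rule order.trans[rotated])
    then have "2 * (s * (arctan (g b / sqrt \<mu>) - arctan (g a / sqrt \<mu>))) / sqrt \<mu> \<le> 2 * pi / sqrt \<mu>"
      using \<mu>(1) by (intro divide_right_mono) auto
    then show ?thesis by (simp add: G_def algebra_simps diff_divide_distrib)
  qed
  then have "norm (integral {a..b} (\<lambda>t. unit_character (f t))) \<le> (1 / 12) / sqrt \<mu> + (1 / 12) / sqrt \<mu> + 2 * pi / sqrt \<mu>"
    using I norm_triangle_ineq4[of "F b" "F a"] nF[of a] nF[of b] by linarith
  also have "\<dots> = (1 / 6 + 2 * pi) / sqrt \<mu>"
    by (simp add: add_divide_distrib)
  also have "\<dots> \<le> 7 / sqrt \<mu>"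
    using \<mu>(1) pi_less_4 pi_approx by (intro divide_right_mono) auto
  finally show ?thesis .
qed

section \<open>Plane arcs of bounded curvature\<close>

text \<open>Pythagoras in the orthogonal frame \<open>T, v / norm v\<close> of the plane, multiplied by \<open>(norm v)\<^sup>2\<close>.\<close>

lemma planar_inner_decomposition:
  fixes h T v :: "real ^ 2"
  assumes "norm T = 1" "T \<bullet> v = 0"
  shows "(T \<bullet> h)\<^sup>2 * (norm v)\<^sup>2 + (v \<bullet> h)\<^sup>2 = (norm h)\<^sup>2 * (norm v)\<^sup>2"
proof -
  obtain a b c d x y where ab: "T $ 1 = a" "T $ 2 = b" "v $ 1 = c" "v $ 2 = d" "h $ 1 = x" "h $ 2 = y"
    by auto
  have 1: "a * a + b * b = 1"
    using assms(1) ab by (simp add: norm_eq_1 inner_vec_def sum_2)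
  have 0: "a * c + b * d = 0"
    using assms(2) ab by (simp add: inner_vec_def sum_2)
  define s where "s = a * d - b * c"
  have c: "c = - b * s" and d: "d = a * s"
    using 0 1 unfolding s_def by algebra+
  have n: "(norm w)\<^sup>2 = w $ 1 * w $ 1 + w $ 2 * w $ 2" for w :: "real ^ 2"
    unfolding power2_norm_eq_inner by (simp add: inner_vec_def sum_2)
  have v: "(norm v)\<^sup>2 = s * s"
    unfolding n ab c d using 1 by algebra
  have "(a * x + b * y)\<^sup>2 * (s * s) + (- b * s * x + a * s * y)\<^sup>2 = (x * x + y * y) * (s * s)"
    using 1 by algebra
  then show ?thesis
    unfolding v by (simp add: n[of h] inner_vec_def sum_2 ab c d)
qed

lemma vector_derivative_of_constant_on:
  fixes q :: "real \<Rightarrow> real"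
  assumes "a < b" "t \<in> {a..b}" "(q has_vector_derivative D) (at t within {a..b})"
    and "\<And>t. t \<in> {a..b} \<Longrightarrow> q t = k"
  shows "D = 0"
proof -
  have "((\<lambda>_. k) has_vector_derivative D) (at t within {a..b})"
    by (rule has_vector_derivative_transform[OF assms(2) _ assms(3)]) (simp add: assms(4))
  moreover have "((\<lambda>_. k) has_vector_derivative 0) (at t within {a..b})" by simp
  ultimately show ?thesis
    using vector_derivative_unique_within_closed_interval[of a b t "\<lambda>_. k" D 0] assms(1,2) by simp
qed

lemma unit_speed_perpendicular:
  fixes T :: "real \<Rightarrow> 'a :: real_inner"
  assumes "0 < l" "t \<in> {0..l}"
    and T: "(T has_vector_derivative v) (at t within {0..l})" "\<And>t. t \<in> {0..l} \<Longrightarrow> norm (T t) = 1"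
  shows "T t \<bullet> v = 0"
proof -
  have "((\<lambda>t. T t \<bullet> T t) has_vector_derivative (T t \<bullet> v + v \<bullet> T t)) (at t within {0..l})"
    by (rule bounded_bilinear.has_vector_derivative[OF bounded_bilinear_inner T(1) T(1)])
  then have "T t \<bullet> v + v \<bullet> T t = 0"
    by (rule vector_derivative_of_constant_on[OF assms(1,2), where k = 1]) (use T(2) in \<open>simp add: norm_eq_1\<close>)
  then show ?thesis by (simp add: inner_commute)
qed

lemma has_vector_derivative_inner_const:
  assumes "(\<gamma> has_vector_derivative v) F"
  shows "((\<lambda>t. \<gamma> t \<bullet> h) has_vector_derivative v \<bullet> h) F"
  by (rule bounded_linear.has_vector_derivative[OF bounded_linear_inner_left assms])

lemma vector_derivative_bound_real:
  fixes g :: "real \<Rightarrow> real"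
  assumes "\<And>t. t \<in> {a..b} \<Longrightarrow> (g has_vector_derivative g' t) (at t within {a..b})"
    and "\<And>t. t \<in> {a..b} \<Longrightarrow> \<bar>g' t\<bar> \<le> B" and "s \<in> {a..b}" "t \<in> {a..b}"
  shows "\<bar>g s - g t\<bar> \<le> B * (b - a)"
proof -
  have "norm (g s - g t) \<le> B * norm (s - t)"
    by (rule field_differentiable_bound[of "{a..b}" g g'])
       (use assms in \<open>auto simp: has_real_derivative_iff_has_vector_derivative\<close>)
  moreover have "B \<ge> 0" using assms(2,3) by (meson abs_ge_zero order_trans)
  then have "B * norm (s - t) \<le> B * (b - a)"
    using assms(3,4) by (intro mult_left_mono) auto
  ultimately show ?thesis by simp
qed

text \<open>The tangent moves by at most 1/2 along the arc.  So either \<open>h\<close> keeps a tangential component of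
  size at least \<open>norm h / 4\<close> throughout, and the first derivative test applies to the phase \<open>\<gamma> t \<bullet> h\<close>,
  or its tangential component never exceeds \<open>3 / 4\<close> of \<open>norm h\<close>.  In the latter case its normal component,
  hence also the second derivative of the phase, stays bounded away from zero.\<close>

lemma oscillatory_integral_along_arc:
  fixes \<gamma> \<gamma>' \<gamma>'' :: "real \<Rightarrow> real ^ 2"
  assumes m: "0 < m"
    and \<gamma>: "\<And>t. t \<in> {0..m} \<Longrightarrow> (\<gamma> has_vector_derivative \<gamma>' t) (at t within {0..m})"
    and \<gamma>': "\<And>t. t \<in> {0..m} \<Longrightarrow> (\<gamma>' has_vector_derivative \<gamma>'' t) (at t within {0..m})"
    and cont: "continuous_on {0..m} \<gamma>''"
    and unit: "\<And>t. t \<in> {0..m} \<Longrightarrow> norm (\<gamma>' t) = 1"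
    and \<kappa>: "0 < \<kappa>" "\<And>t. t \<in> {0..m} \<Longrightarrow> \<kappa> \<le> norm (\<gamma>'' t)" "\<And>t. t \<in> {0..m} \<Longrightarrow> norm (\<gamma>'' t) \<le> 2 * \<kappa>"
    and short: "4 * \<kappa> * m \<le> 1" and h: "h \<noteq> 0"
  shows "norm (integral {0..m} (\<lambda>t. unit_character (\<gamma> t \<bullet> h))) \<le> 3 / norm h + 10 / sqrt (\<kappa> * norm h)"
proof -
  have h0: "norm h > 0" using h by simp
  note f = has_vector_derivative_inner_const[OF \<gamma>, of _ h]
  note g = has_vector_derivative_inner_const[OF \<gamma>', of _ h]
  have g'B: "\<bar>\<gamma>'' t \<bullet> h\<bar> \<le> 2 * \<kappa> * norm h" if "t \<in> {0..m}" for t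
    using Cauchy_Schwarz_ineq2[of "\<gamma>'' t" h] mult_right_mono[OF \<kappa>(3)[OF that], of "norm h"] by simp
  show ?thesis
  proof (cases "\<forall>t\<in>{0..m}. norm h / 4 \<le> \<bar>\<gamma>' t \<bullet> h\<bar>")
    case True
    have "norm (integral {0..m} (\<lambda>t. unit_character (\<gamma> t \<bullet> h)))
        \<le> (2 + 2 * \<kappa> * norm h * (m - 0) / (norm h / 4)) / (2 * pi * (norm h / 4))"
      by (rule first_derivative_test[OF _ f g]) (use m h0 True g'B in auto)
    also have "\<dots> = (2 + 2 * (4 * \<kappa> * m)) * 2 / (pi * norm h)"
      using h0 by (simp add: field_simps)
    also have "\<dots> \<le> 9 / (3 * norm h)"
      using h0 short pi_gt3 by (intro frac_le mult_right_mono) auto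
    also have "\<dots> = 3 / norm h" by simp
    finally show ?thesis using \<kappa>(1) h0 by (simp add: add_increasing2)
  next
    case False
    then obtain s where s: "s \<in> {0..m}" "\<bar>\<gamma>' s \<bullet> h\<bar> < norm h / 4" by auto
    define \<mu> where "\<mu> = \<kappa> * norm h / 2"
    have \<mu>: "\<mu> > 0" using \<kappa>(1) h0 by (simp add: \<mu>_def)
    have g': "\<mu> \<le> \<bar>\<gamma>'' t \<bullet> h\<bar>" if t: "t \<in> {0..m}" for t
    proof -
      have "\<bar>\<gamma>' t \<bullet> h - \<gamma>' s \<bullet> h\<bar> \<le> 2 * \<kappa> * norm h * (m - 0)"
        by (rule vector_derivative_bound_real[OF g g'B t s(1)])
      also have "\<dots> \<le> norm h / 2"
        using mult_right_mono[OF short, of "norm h"] by (simp add: algebra_simps)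
      finally have "\<bar>\<gamma>' t \<bullet> h\<bar> \<le> 3 / 4 * norm h" using s(2) by linarith
      then have *: "(\<gamma>' t \<bullet> h)\<^sup>2 \<le> (3 / 4 * norm h)\<^sup>2" using h0 by (simp add: abs_le_square_iff[symmetric])
      have "(norm h)\<^sup>2 / 4 \<le> (norm h)\<^sup>2 - (\<gamma>' t \<bullet> h)\<^sup>2"
      proof -
        have "(3 / 4 * norm h)\<^sup>2 = 9 / 16 * (norm h)\<^sup>2" by (simp add: power_mult_distrib power_divide)
        then show ?thesis using * zero_le_power2[of "norm h"] by linarith
      qed
      then have "(norm h)\<^sup>2 / 4 * (norm (\<gamma>'' t))\<^sup>2 \<le> ((norm h)\<^sup>2 - (\<gamma>' t \<bullet> h)\<^sup>2) * (norm (\<gamma>'' t))\<^sup>2"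
        by (intro mult_right_mono) auto
      also have "\<dots> = (\<gamma>'' t \<bullet> h)\<^sup>2"
        using planar_inner_decomposition[OF unit[OF t] unit_speed_perpendicular[OF m t \<gamma>'[OF t] unit], of h]
        by (simp add: algebra_simps)
      finally have "(norm h)\<^sup>2 / 4 * (norm (\<gamma>'' t))\<^sup>2 \<le> (\<gamma>'' t \<bullet> h)\<^sup>2" .
      moreover have "\<mu>\<^sup>2 \<le> (norm h)\<^sup>2 / 4 * (norm (\<gamma>'' t))\<^sup>2"
      proof -
        have "\<kappa>\<^sup>2 \<le> (norm (\<gamma>'' t))\<^sup>2" using \<kappa>(1) \<kappa>(2)[OF t] by (intro power_mono) auto
        then have "(norm h)\<^sup>2 / 4 * \<kappa>\<^sup>2 \<le> (norm h)\<^sup>2 / 4 * (norm (\<gamma>'' t))\<^sup>2"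
          by (intro mult_left_mono) auto
        then show ?thesis by (simp add: \<mu>_def power_divide power_mult_distrib mult.commute)
      qed
      ultimately have "\<mu>\<^sup>2 \<le> (\<gamma>'' t \<bullet> h)\<^sup>2" by (rule order.trans[rotated])
      then show ?thesis using \<mu> by (simp add: abs_le_square_iff[symmetric])
    qed
    have conn: "connected ((\<lambda>t. \<gamma>'' t \<bullet> h) ` {0..m})"
      by (intro connected_continuous_image continuous_intros cont) auto
    have sign: "\<exists>\<sigma>. \<bar>\<sigma>\<bar> = 1 \<and> (\<forall>t\<in>{0..m}. \<mu> \<le> \<sigma> * (\<gamma>'' t \<bullet> h))"
    proof (cases "\<exists>t\<in>{0..m}. \<gamma>'' t \<bullet> h < 0")
      case False
      then have "\<mu> \<le> 1 * (\<gamma>'' t \<bullet> h)" if "t \<in> {0..m}" for t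
        using g'[OF that] that by (auto simp: abs_if split: if_splits)
      then show ?thesis by (intro exI[of _ 1]) auto
    next
      case True
      then obtain t where t: "t \<in> {0..m}" "\<gamma>'' t \<bullet> h < 0" by auto
      have "\<gamma>'' r \<bullet> h < 0" if r: "r \<in> {0..m}" for r
      proof (rule ccontr)
        assume "\<not> ?thesis"
        then have "0 \<in> (\<lambda>t. \<gamma>'' t \<bullet> h) ` {0..m}"
          using connectedD_interval[OF conn, of "\<gamma>'' t \<bullet> h" "\<gamma>'' r \<bullet> h" 0] t r by auto
        then show False using g' \<mu> by fastforce
      qed
      then have "\<mu> \<le> (- 1) * (\<gamma>'' t \<bullet> h)" if "t \<in> {0..m}" for t
        using g'[OF that] that by (auto simp: abs_if split: if_splits)
      then show ?thesis by (intro exI[of _ "- 1"]) auto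
    qed
    then obtain \<sigma> where \<sigma>: "\<bar>\<sigma>\<bar> = 1" "\<And>t. t \<in> {0..m} \<Longrightarrow> \<mu> \<le> \<sigma> * (\<gamma>'' t \<bullet> h)" by auto
    have "norm (integral {0..m} (\<lambda>t. unit_character (\<gamma> t \<bullet> h))) \<le> 7 / sqrt \<mu>"
      by (rule second_derivative_test[OF _ f g \<sigma>(1) \<mu> \<sigma>(2)]) (use m in auto)
    also have "7 / sqrt \<mu> = 7 * sqrt 2 / sqrt (\<kappa> * norm h)"
      by (simp add: \<mu>_def real_sqrt_divide)
    also have "\<dots> \<le> 10 / sqrt (\<kappa> * norm h)"
    proof -
      have "sqrt 2 \<le> 10 / 7" by (rule real_le_lsqrt) (auto simp: power2_eq_square)
      then show ?thesis using \<kappa>(1) by (intro divide_right_mono) auto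
    qed
    finally show ?thesis using h0 by (simp add: add_increasing)
  qed
qed

text \<open>Use the two supporting lines parallel to the initial tangent: the curve leaves this tangent
  only to second order.  The curvature ensures that these two lines are distinct.\<close>

lemma curve_width_le:
  assumes l: "0 < l"
    and \<gamma>: "\<And>t. t \<in> {0..l} \<Longrightarrow> (\<gamma> has_vector_derivative \<gamma>' t) (at t within {0..l})"
    and \<gamma>': "\<And>t. t \<in> {0..l} \<Longrightarrow> (\<gamma>' has_vector_derivative \<gamma>'' t) (at t within {0..l})"
    and unit: "\<And>t. t \<in> {0..l} \<Longrightarrow> norm (\<gamma>' t) = 1"
    and \<kappa>: "\<And>t. t \<in> {0..l} \<Longrightarrow> 0 < norm (\<gamma>'' t)" "\<And>t. t \<in> {0..l} \<Longrightarrow> norm (\<gamma>'' t) \<le> 2 * \<kappa>"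
  shows "curve_width (\<gamma> ` {0..l}) \<le> 2 * \<kappa> * l\<^sup>2"
proof -
  have l0: "0 \<in> {0..l}" using l by simp
  \<comment> \<open>The initial tangent rotated by a right angle.\<close>
  define u :: "real ^ 2" where "u = vector [- (\<gamma>' 0 $ 2), \<gamma>' 0 $ 1]"
  have u: "norm u = 1" "\<gamma>' 0 \<bullet> u = 0"
    using unit[OF l0] by (auto simp: u_def norm_eq_1 inner_vec_def sum_2 vector_2)
  note p = has_vector_derivative_inner_const[OF \<gamma>, of _ u]
  note p' = has_vector_derivative_inner_const[OF \<gamma>', of _ u]
  have p''B: "\<bar>\<gamma>'' t \<bullet> u\<bar> \<le> 2 * \<kappa>" if "t \<in> {0..l}" for t
    using Cauchy_Schwarz_ineq2[of "\<gamma>'' t" u] \<kappa>(2)[OF that] u(1) by simp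
  have p'B: "\<bar>\<gamma>' t \<bullet> u\<bar> \<le> 2 * \<kappa> * l" if "t \<in> {0..l}" for t
    using vector_derivative_bound_real[OF p' p''B that l0] u(2) by simp
  have pB: "\<bar>\<gamma> s \<bullet> u - \<gamma> t \<bullet> u\<bar> \<le> 2 * \<kappa> * l\<^sup>2" if "s \<in> {0..l}" "t \<in> {0..l}" for s t
    using vector_derivative_bound_real[OF p p'B that] by (simp add: power2_eq_square)
  have cont: "continuous_on {0..l} (\<lambda>t. \<gamma> t \<bullet> u)"
    by (rule continuous_on_vector_derivative[OF p])
  obtain s where s: "s \<in> {0..l}" "\<And>t. t \<in> {0..l} \<Longrightarrow> \<gamma> t \<bullet> u \<le> \<gamma> s \<bullet> u"
    using continuous_attains_sup[OF _ _ cont] l by auto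
  obtain r where r: "r \<in> {0..l}" "\<And>t. t \<in> {0..l} \<Longrightarrow> \<gamma> r \<bullet> u \<le> \<gamma> t \<bullet> u"
    using continuous_attains_inf[OF _ _ cont] l by auto
  \<comment> \<open>Otherwise the curve would lie on a line and its initial curvature would vanish.\<close>
  have ne: "\<gamma> s \<bullet> u \<noteq> \<gamma> r \<bullet> u"
  proof
    assume eq: "\<gamma> s \<bullet> u = \<gamma> r \<bullet> u"
    have "\<gamma>' t \<bullet> u = 0" if "t \<in> {0..l}" for t
      by (rule vector_derivative_of_constant_on[OF l that p[OF that], where k = "\<gamma> r \<bullet> u"])
         (use s r eq in \<open>auto intro: antisym\<close>)
    then have "\<gamma>'' 0 \<bullet> u = 0"
      by (intro vector_derivative_of_constant_on[OF l l0 p'[OF l0], where k = 0])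
    then have "(norm (\<gamma>'' 0))\<^sup>2 = 0"
      using planar_inner_decomposition[OF unit[OF l0] unit_speed_perpendicular[OF l l0 \<gamma>'[OF l0] unit], of u] u
      by simp
    then show False using \<kappa>(1)[OF l0] by simp
  qed
  let ?S = "{setdist {x. u \<bullet> x = s} {x. u \<bullet> x = t} | u s t.
     s \<noteq> t \<and> supporting_line (\<gamma> ` {0..l}) u s \<and> supporting_line (\<gamma> ` {0..l}) u t}"
  have "supporting_line (\<gamma> ` {0..l}) u (\<gamma> s \<bullet> u)" "supporting_line (\<gamma> ` {0..l}) u (\<gamma> r \<bullet> u)"
    unfolding supporting_line_def using u s r by (auto simp: inner_commute)
  then have "setdist {x. u \<bullet> x = \<gamma> s \<bullet> u} {x. u \<bullet> x = \<gamma> r \<bullet> u} \<in> ?S" using ne by blast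
  moreover have "bdd_below ?S" by (rule bdd_belowI[of _ 0]) (auto simp: setdist_pos_le)
  ultimately have "curve_width (\<gamma> ` {0..l}) \<le> setdist {x. u \<bullet> x = \<gamma> s \<bullet> u} {x. u \<bullet> x = \<gamma> r \<bullet> u}"
    unfolding curve_width_def by (rule cInf_lower)
  also have "\<dots> \<le> dist (\<gamma> s) (\<gamma> s + (\<gamma> r \<bullet> u - \<gamma> s \<bullet> u) *\<^sub>R u)"
  proof (rule setdist_le_dist)
    have "u \<bullet> u = 1" using u(1) by (simp add: norm_eq_1)
    then show "\<gamma> s + (\<gamma> r \<bullet> u - \<gamma> s \<bullet> u) *\<^sub>R u \<in> {x. u \<bullet> x = \<gamma> r \<bullet> u}"
      by (simp add: inner_add_right inner_commute)
  qed (simp add: inner_commute)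
  also have "\<dots> = \<bar>\<gamma> r \<bullet> u - \<gamma> s \<bullet> u\<bar>" using u(1) by (simp add: dist_norm)
  also have "\<dots> \<le> 2 * \<kappa> * l\<^sup>2" by (rule pB[OF r(1) s(1)])
  finally show ?thesis .
qed

section \<open>Eigenfunctions vanishing on an arc\<close>

text \<open>Let \<open>\<zeta>\<close> carry the largest coefficient.  Integrating the eigenfunction along the arc against the
  conjugate of the character of \<open>\<zeta>\<close> gives zero.  The diagonal term of the resulting sum is
  \<open>m * a \<zeta>\<close>, and each of the other terms is at most \<open>c * norm (a \<zeta>)\<close>.\<close>

lemma zero_on_arc_imp_short:
  fixes \<gamma> :: "real \<Rightarrow> real ^ 2"
  assumes eig: "eigenfunction E \<phi>" and sep: "separated d E"
    and m: "0 \<le> m" and cont: "continuous_on {0..m} \<gamma>"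
    and zero: "\<And>t. t \<in> {0..m} \<Longrightarrow> \<phi> (torus_proj (\<gamma> t)) = 0"
    and osc: "\<And>h. h \<noteq> 0 \<Longrightarrow> d \<le> norm h \<Longrightarrow> norm (integral {0..m} (\<lambda>t. unit_character (\<gamma> t \<bullet> h))) \<le> c"
    and c: "0 \<le> c"
  shows "frequencies E \<noteq> {}" and "m \<le> real (card (frequencies E)) * c"
proof -
  obtain a where a: "\<And>x. complex_of_real (\<phi> (torus_proj x)) = (\<Sum>\<xi> \<in> frequencies E. a \<xi> * unit_character (x \<bullet> \<xi>))"
    using eig by (auto simp: eigenfunction_def)
  obtain p where "\<phi> p \<noteq> 0" using eig by (auto simp: eigenfunction_def)
  moreover obtain x where "p = torus_proj x"
    using Quotient_abs_rep[OF Quotient_torus] by metis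
  ultimately have x: "(\<Sum>\<xi> \<in> frequencies E. a \<xi> * unit_character (x \<bullet> \<xi>)) \<noteq> 0"
    using a[of x] by auto
  then obtain \<eta> where \<eta>: "\<eta> \<in> frequencies E" "a \<eta> \<noteq> 0"
    by (metis (no_types, lifting) mult_zero_left sum.neutral)
  then show "frequencies E \<noteq> {}" by auto
  have "Max ((\<lambda>\<xi>. norm (a \<xi>)) ` frequencies E) \<in> (\<lambda>\<xi>. norm (a \<xi>)) ` frequencies E"
    using \<eta> finite_frequencies by (intro Max_in) auto
  then obtain \<zeta> where \<zeta>: "\<zeta> \<in> frequencies E" "norm (a \<zeta>) = Max ((\<lambda>\<xi>. norm (a \<xi>)) ` frequencies E)"
    by auto
  have max: "norm (a \<xi>) \<le> norm (a \<zeta>)" if "\<xi> \<in> frequencies E" for \<xi>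
    using that finite_frequencies unfolding \<zeta>(2) by (intro Max_ge) auto
  have pos: "norm (a \<zeta>) > 0" using max[OF \<eta>(1)] \<eta>(2) by (smt (verit) zero_less_norm_iff)
  define I where "I \<xi> = integral {0..m} (\<lambda>t. unit_character (\<gamma> t \<bullet> (\<xi> - \<zeta>)))" for \<xi>
  have int: "(\<lambda>t. unit_character (\<gamma> t \<bullet> h)) integrable_on {0..m}" for h
  proof (rule integrable_continuous_real)
    show "continuous_on {0..m} (\<lambda>t. unit_character (\<gamma> t \<bullet> h))"
      unfolding unit_character_def by (intro continuous_intros cont)
  qed
  have "((\<lambda>t. \<Sum>\<xi>\<in>frequencies E. a \<xi> * unit_character (\<gamma> t \<bullet> (\<xi> - \<zeta>))) has_integral
      (\<Sum>\<xi>\<in>frequencies E. a \<xi> * I \<xi>)) {0..m}"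
    unfolding I_def
    by (intro has_integral_sum has_integral_mult_right integrable_integral int finite_frequencies)
  moreover have "((\<lambda>t. \<Sum>\<xi>\<in>frequencies E. a \<xi> * unit_character (\<gamma> t \<bullet> (\<xi> - \<zeta>))) has_integral 0) {0..m}"
  proof (rule has_integral_is_0)
    fix t assume t: "t \<in> {0..m}"
    have "(\<Sum>\<xi>\<in>frequencies E. a \<xi> * unit_character (\<gamma> t \<bullet> (\<xi> - \<zeta>)))
        = (\<Sum>\<xi>\<in>frequencies E. a \<xi> * unit_character (\<gamma> t \<bullet> \<xi>)) * unit_character (- (\<gamma> t \<bullet> \<zeta>))"
      unfolding sum_distrib_right
      by (intro sum.cong refl) (simp add: inner_diff_right flip: unit_character_add)
    also have "\<dots> = 0" using zero[OF t] a[of "\<gamma> t"] by simp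
    finally show "(\<Sum>\<xi>\<in>frequencies E. a \<xi> * unit_character (\<gamma> t \<bullet> (\<xi> - \<zeta>))) = 0" .
  qed
  ultimately have "(\<Sum>\<xi>\<in>frequencies E. a \<xi> * I \<xi>) = 0" by (rule has_integral_unique)
  moreover have "I \<zeta> = of_real m"
    using m by (simp add: I_def unit_character_def scaleR_conv_of_real)
  ultimately have "a \<zeta> * of_real m + (\<Sum>\<xi>\<in>frequencies E - {\<zeta>}. a \<xi> * I \<xi>) = 0"
    using sum.remove[OF finite_frequencies \<zeta>(1), of "\<lambda>\<xi>. a \<xi> * I \<xi>"] by simp
  then have "a \<zeta> * of_real m = - (\<Sum>\<xi>\<in>frequencies E - {\<zeta>}. a \<xi> * I \<xi>)"
    by (simp only: eq_neg_iff_add_eq_0)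
  then have "norm (a \<zeta>) * m = norm (\<Sum>\<xi>\<in>frequencies E - {\<zeta>}. a \<xi> * I \<xi>)"
    using m by (metis abs_of_nonneg norm_minus_cancel norm_mult norm_of_real)
  also have "\<dots> \<le> (\<Sum>\<xi>\<in>frequencies E - {\<zeta>}. norm (a \<zeta>) * c)"
  proof (rule sum_norm_le)
    fix \<xi> assume \<xi>: "\<xi> \<in> frequencies E - {\<zeta>}"
    have "norm (I \<xi>) \<le> c"
      unfolding I_def using \<xi> \<zeta>(1) sep by (intro osc) (auto simp: separated_def)
    then show "norm (a \<xi> * I \<xi>) \<le> norm (a \<zeta>) * c"
      unfolding norm_mult using max[of \<xi>] \<xi> by (intro mult_mono) auto
  qed
  also have "\<dots> = norm (a \<zeta>) * (real (card (frequencies E - {\<zeta>})) * c)" by simp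
  also have "\<dots> \<le> norm (a \<zeta>) * (real (card (frequencies E)) * c)"
    using c finite_frequencies by (intro mult_left_mono mult_right_mono) (auto intro: card_mono)
  finally show "m \<le> real (card (frequencies E)) * c" using pos by simp
qed

text \<open>The first half of the arc turns by at most 1/2, as the oscillatory estimate requires.
  With \<open>M\<close> frequencies it yields \<open>l \<le> M (6 / d + 20 / sqrt (\<kappa> d))\<close>.  Multiplied by \<open>\<kappa> l\<close>, this becomes a
  quadratic inequality for \<open>X = sqrt \<kappa> * l\<close>, whose solution bounds \<open>\<kappa> l\<^sup>2\<close> and with it the width.\<close>

lemma curve_width_nodal_arc_le:
  assumes eig: "eigenfunction E \<phi>" and arc: "regular_arc_lift C K" and sub: "C \<subseteq> nodal_set \<phi>"
    and sep: "separated d E" and d: "0 < d"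
  shows "curve_width K \<le> 812 * (real (card (frequencies E)))\<^sup>2 / d"
proof -
  obtain \<gamma> l \<gamma>' \<gamma>'' \<kappa> where l: "0 < l" and K: "K = \<gamma> ` {0..l}" "C = torus_proj ` K"
    and \<gamma>: "\<And>t. t \<in> {0..l} \<Longrightarrow> (\<gamma> has_vector_derivative \<gamma>' t) (at t within {0..l})"
    and \<gamma>': "\<And>t. t \<in> {0..l} \<Longrightarrow> (\<gamma>' has_vector_derivative \<gamma>'' t) (at t within {0..l})"
    and cont: "continuous_on {0..l} \<gamma>''"
    and unit: "\<And>t. t \<in> {0..l} \<Longrightarrow> norm (\<gamma>' t) = 1"
    and \<kappa>: "0 < \<kappa>" "\<And>t. t \<in> {0..l} \<Longrightarrow> \<kappa> < norm (\<gamma>'' t) \<and> norm (\<gamma>'' t) < 2 * \<kappa>" "2 * \<kappa> * l < 1"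
    using arc unfolding regular_arc_lift_def regular_parametrization_def by metis
  define m where "m = l / 2"
  have m: "0 < m" "{0..m} \<subseteq> {0..l}" using l by (auto simp: m_def)
  define c where "c = 3 / d + 10 / sqrt (\<kappa> * d)"
  define M where "M = real (card (frequencies E))"
  have osc: "norm (integral {0..m} (\<lambda>t. unit_character (\<gamma> t \<bullet> h))) \<le> c" if h: "h \<noteq> 0" "d \<le> norm h" for h
  proof -
    have "norm (integral {0..m} (\<lambda>t. unit_character (\<gamma> t \<bullet> h))) \<le> 3 / norm h + 10 / sqrt (\<kappa> * norm h)"
    proof (rule oscillatory_integral_along_arc[of m \<gamma> \<gamma>' \<gamma>''])
      fix t assume "t \<in> {0..m}"
      then have t: "t \<in> {0..l}" using m by auto
      show "(\<gamma> has_vector_derivative \<gamma>' t) (at t within {0..m})"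
        by (rule has_vector_derivative_within_subset[OF \<gamma>[OF t] m(2)])
      show "(\<gamma>' has_vector_derivative \<gamma>'' t) (at t within {0..m})"
        by (rule has_vector_derivative_within_subset[OF \<gamma>'[OF t] m(2)])
      show "norm (\<gamma>' t) = 1" "\<kappa> \<le> norm (\<gamma>'' t)" "norm (\<gamma>'' t) \<le> 2 * \<kappa>"
        using unit[OF t] \<kappa>(2)[OF t] by auto
    qed (use m \<kappa> h continuous_on_subset[OF cont m(2)] in \<open>auto simp: m_def\<close>)
    also have "\<dots> \<le> c"
      unfolding c_def using d \<kappa>(1) h(2) by (intro add_mono frac_le) auto
    finally show ?thesis .
  qed
  have c: "0 \<le> c" using d \<kappa>(1) by (simp add: c_def)
  have cont\<gamma>: "continuous_on {0..m} \<gamma>"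
    using continuous_on_vector_derivative[OF \<gamma>] continuous_on_subset m(2) by blast
  have zero: "\<phi> (torus_proj (\<gamma> t)) = 0" if "t \<in> {0..m}" for t
    using sub that m(2) by (force simp: K nodal_set_def)
  note short = zero_on_arc_imp_short[OF eig sep less_imp_le[OF m(1)] cont\<gamma> zero osc c]
  have M: "1 \<le> M"
    using short(1) finite_frequencies by (simp add: M_def card_gt_0_iff Suc_le_eq)
  have lM: "l \<le> 2 * M * c" using short(2) by (simp add: M_def m_def)
  define X where "X = sqrt \<kappa> * l"
  have X: "X * X = \<kappa> * l * l" using \<kappa>(1) by (simp add: X_def)
  have "X * X \<le> \<kappa> * l * (2 * M * c)"
    unfolding X using lM \<kappa>(1) l by (intro mult_left_mono) auto
  also have "\<dots> = 3 * (2 * \<kappa> * l) * (M / d) + 20 * (X * (M / sqrt d))"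
  proof -
    have "\<kappa> / sqrt (\<kappa> * d) = sqrt \<kappa> / sqrt d"
      using \<kappa>(1) by (simp add: real_sqrt_mult real_div_sqrt flip: divide_divide_eq_left)
    then have "20 * (l * (M * (\<kappa> / sqrt (\<kappa> * d)))) = 20 * (X * (M / sqrt d))"
      by (simp add: X_def)
    moreover have "\<kappa> * l * (2 * M * c) = 3 * (2 * \<kappa> * l) * (M / d) + 20 * (l * (M * (\<kappa> / sqrt (\<kappa> * d))))"
      by (simp add: c_def ring_distribs mult_ac)
    ultimately show ?thesis by simp
  qed
  also have "3 * (2 * \<kappa> * l) * (M / d) \<le> 3 * 1 * (M\<^sup>2 / d)"
    using \<kappa> l M d by (intro mult_mono divide_right_mono) (auto simp: self_le_power)
  also have "20 * (X * (M / sqrt d)) \<le> X * X / 2 + 200 * (M\<^sup>2 / d)"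
  proof -
    have "0 \<le> (X - 20 * (M / sqrt d))\<^sup>2" by simp
    also have "(X - 20 * (M / sqrt d))\<^sup>2 = X * X - 40 * (X * (M / sqrt d)) + 400 * (M / sqrt d)\<^sup>2"
      by (simp only: power2_eq_square) (simp add: algebra_simps)
    also have "(M / sqrt d)\<^sup>2 = M\<^sup>2 / d" using d by (simp add: power_divide)
    finally show ?thesis by linarith
  qed
  finally have X2: "2 * (X * X) \<le> 812 * (M\<^sup>2 / d)" by simp
  have curv: "0 < norm (\<gamma>'' t)" "norm (\<gamma>'' t) \<le> 2 * \<kappa>" if "t \<in> {0..l}" for t
    using \<kappa>(1) \<kappa>(2)[OF that] by linarith+
  have "curve_width K \<le> 2 * (\<kappa> * l * l)"
    unfolding K using curve_width_le[OF l \<gamma> \<gamma>' unit curv] by (simp add: power2_eq_square mult.assoc)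
  also have "\<dots> \<le> 812 * (M\<^sup>2 / d)" using X2 unfolding X .
  finally show ?thesis by (simp add: M_def)
qed

section \<open>Conclusion for almost all eigenvalues\<close>

text \<open>Cover the plane by squares of side \<open>d / 2\<close>: each contains at most one frequency.\<close>

lemma card_frequencies_le_of_separated:
  assumes sep: "separated d E" and d: "0 < d"
  shows "real (card (frequencies E)) \<le> (4 * sqrt (real E) / d + 2)\<^sup>2"
proof -
  define q where "q = \<lfloor>2 * sqrt (real E) / d\<rfloor>"
  have q0: "0 \<le> q" using d by (simp add: q_def)
  \<comment> \<open>Two points of the same square have coordinates differing by less than \<open>d / 2\<close>.\<close>
  define \<Phi> where "\<Phi> \<xi> = (\<lfloor>2 * (\<xi> $ 1) / d\<rfloor>, \<lfloor>2 * (\<xi> $ 2) / d\<rfloor>)" for \<xi> :: "real ^ 2"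
  have "inj_on \<Phi> (frequencies E)"
  proof (rule inj_onI, rule ccontr)
    fix \<xi> \<eta> assume fr: "\<xi> \<in> frequencies E" "\<eta> \<in> frequencies E" and eq: "\<Phi> \<xi> = \<Phi> \<eta>" and ne: "\<xi> \<noteq> \<eta>"
    have close: "\<bar>x - y\<bar> < d / 2" if "\<lfloor>2 * x / d\<rfloor> = \<lfloor>2 * y / d\<rfloor>" for x y :: real
    proof -
      have "\<bar>2 * x / d - 2 * y / d\<bar> < 1" using that by linarith
      moreover have "2 * x / d - 2 * y / d = 2 * (x - y) / d"
        by (simp add: right_diff_distrib diff_divide_distrib)
      ultimately have "\<bar>2 * (x - y)\<bar> / d < 1" using d by simp
      then have "\<bar>2 * (x - y)\<bar> < d" using d by (simp add: pos_divide_less_eq)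
      then have "2 * \<bar>x - y\<bar> < d" by (simp only: abs_mult abs_numeral)
      then show ?thesis by simp
    qed
    have "norm (\<xi> - \<eta>) \<le> \<bar>(\<xi> - \<eta>) $ 1\<bar> + \<bar>(\<xi> - \<eta>) $ 2\<bar>"
      using norm_le_l1_cart[of "\<xi> - \<eta>"] by (simp add: sum_2)
    also have "\<dots> < d / 2 + d / 2"
      using eq close[of "\<xi> $ 1" "\<eta> $ 1"] close[of "\<xi> $ 2" "\<eta> $ 2"] by (auto simp: \<Phi>_def)
    finally show False using sep fr ne by (force simp: separated_def)
  qed
  moreover have "\<Phi> ` frequencies E \<subseteq> {- q - 1..q} \<times> {- q - 1..q}"
  proof -
    have "\<lfloor>2 * (\<xi> $ i) / d\<rfloor> \<in> {- q - 1..q}" if "\<xi> \<in> frequencies E" for \<xi> i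
    proof -
      have "norm \<xi> = sqrt (real E)" using that by (auto simp: frequencies_def real_sqrt_unique)
      then have "\<bar>\<xi> $ i\<bar> \<le> sqrt (real E)" using component_le_norm_cart[of \<xi> i] by simp
      then have "\<bar>2 * (\<xi> $ i) / d\<bar> \<le> 2 * sqrt (real E) / d"
        using d by (simp add: abs_mult divide_right_mono)
      then show ?thesis unfolding q_def atLeastAtMost_iff by linarith
    qed
    then show ?thesis by (auto simp: \<Phi>_def)
  qed
  ultimately have "card (frequencies E) \<le> card ({- q - 1..q} \<times> {- q - 1..q})"
    by (rule card_inj_on_le) simp
  also have "\<dots> = nat (2 + 2 * q) * nat (2 + 2 * q)"
    by (simp add: card_cartesian_product)
  finally have "real (card (frequencies E)) \<le> real (nat (2 + 2 * q) * nat (2 + 2 * q))" by (simp only: of_nat_le_iff)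
  also have "\<dots> = (2 * of_int q + 2)\<^sup>2"
  proof -
    have "real (nat (2 + 2 * q)) = 2 * of_int q + 2" using q0 by simp
    then show ?thesis by (simp only: of_nat_mult power2_eq_square)
  qed
  also have "\<dots> \<le> (4 * sqrt (real E) / d + 2)\<^sup>2"
  proof (rule power_mono)
    have "of_int q \<le> 2 * sqrt (real E) / d" unfolding q_def by (rule of_int_floor_le)
    then show "2 * of_int q + 2 \<le> 4 * sqrt (real E) / d + 2" by simp
  qed (use q0 in simp)
  finally show ?thesis .
qed

lemma width_bound_of_separated:
  assumes E: "E \<ge> 1" and \<delta>: "0 < \<delta>" and sep: "separated (sqrt (real E) powr (1 - \<delta>)) E"
    and eig: "eigenfunction E \<phi>" and arc: "regular_arc_lift C K" and sub: "C \<subseteq> nodal_set \<phi>"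
  shows "curve_width K \<le> 1052352 * sqrt (real E) powr (- 1 + 5 * \<delta>)"
proof -
  define r where "r = sqrt (real E)"
  have r: "r \<ge> 1" using E by (simp add: r_def)
  define d where "d = r powr (1 - \<delta>)"
  have d: "d > 0" using r by (simp add: d_def)
  have "r / d = r powr \<delta>"
    using r unfolding d_def by (metis powr_diff powr_one diff_diff_eq2 add_diff_cancel_left' less_le_trans zero_less_one less_imp_le)
  moreover have p1: "1 \<le> r powr \<delta>" using r \<delta> by (simp add: ge_one_powr_ge_zero)
  ultimately have "4 * r / d + 2 \<le> 6 * r powr \<delta>" by (simp flip: times_divide_eq_right)
  then have "(4 * r / d + 2)\<^sup>2 \<le> (6 * r powr \<delta>)\<^sup>2" using r d by (intro power_mono) auto
  then have M: "real (card (frequencies E)) \<le> 36 * (r powr \<delta>)\<^sup>2"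
    using card_frequencies_le_of_separated[of d E] sep d by (simp add: d_def r_def power_mult_distrib)
  have "curve_width K \<le> 812 * (real (card (frequencies E)))\<^sup>2 / d"
    by (rule curve_width_nodal_arc_le[OF eig arc sub _ d]) (use sep in \<open>simp add: d_def r_def\<close>)
  also have "\<dots> \<le> 812 * (36 * (r powr \<delta>)\<^sup>2)\<^sup>2 / d"
    using M d by (intro divide_right_mono mult_left_mono power_mono) auto
  also have "\<dots> = 1052352 * ((r powr \<delta>) ^ 4 / d)"
    by (simp add: power_mult_distrib flip: power_mult)
  also have "(r powr \<delta>) ^ 4 / d = r powr (- 1 + 5 * \<delta>)"
  proof -
    have "(r powr \<delta>) ^ 4 = r powr (4 * \<delta>)" using r by (simp add: powr_power mult.commute)
    then show ?thesis unfolding d_def by (simp add: algebra_simps flip: powr_diff)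
  qed
  finally show ?thesis by (simp add: r_def)
qed

lemma almost_all_separated:
  fixes \<delta> :: real
  assumes \<delta>: "0 < \<delta>" "\<delta> \<le> 1"
  shows "almost_all_sums_of_two_squares (\<lambda>E. separated (sqrt (real E) powr (1 - \<delta>)) E)"
proof -
  define b where "b N = 63072 * (real N powr (- \<delta> / 2) * (1 + ln (real N))\<^sup>2)" for N
  let ?S = "\<lambda>N. {E \<in> sums_of_two_squares. E \<le> N \<and> \<not> separated (sqrt (real E) powr (1 - \<delta>)) E}"
  let ?B = "\<lambda>N. {E \<in> sums_of_two_squares. E \<le> N}"
  have "(\<lambda>N. b N) \<longlonglongrightarrow> 0" unfolding b_def using \<delta>(1) by real_asymp
  moreover have "real (card (?S N)) / real (card (?B N)) \<le> b N" if N: "N \<ge> 2" for N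
  proof -
    have ln: "1 + ln (real N) > 0" using N by (simp add: add_pos_nonneg)
    have "real (card (?S N)) / real (card (?B N))
        \<le> 108 * (real N powr (1 - \<delta> / 2) * (1 + ln (real N))) / (real N / (584 * (1 + ln (real N))))"
      using card_not_separated_le[OF \<delta>, of N] card_sums_of_two_squares_ge[OF N] N ln
      by (intro frac_le) auto
    also have "\<dots> = 63072 * (real N powr (1 - \<delta> / 2) / real N * (1 + ln (real N))\<^sup>2)"
      using ln by (simp add: power2_eq_square)
    also have "real N powr (1 - \<delta> / 2) / real N = real N powr (- \<delta> / 2)"
      using powr_diff[of "real N" "1 - \<delta> / 2" 1] N by simp
    finally show ?thesis by (simp add: b_def)
  qed
  then have "\<forall>\<^sub>F N in sequentially. real (card (?S N)) / real (card (?B N)) \<le> b N"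
    by (intro eventually_sequentiallyI[of 2])
  ultimately show ?thesis
    unfolding almost_all_sums_of_two_squares_def
    by - (rule tendsto_sandwich[OF _ _ tendsto_const], simp_all)
qed

lemma almost_all_sums_of_two_squares_mono:
  assumes "almost_all_sums_of_two_squares P" and "\<And>E. E \<in> sums_of_two_squares \<Longrightarrow> P E \<Longrightarrow> Q E"
  shows "almost_all_sums_of_two_squares Q"
  unfolding almost_all_sums_of_two_squares_def
proof (rule tendsto_sandwich[OF _ _ tendsto_const])
  show "(\<lambda>N. real (card {E \<in> sums_of_two_squares. E \<le> N \<and> \<not> P E}) / real (card {E \<in> sums_of_two_squares. E \<le> N})) \<longlonglongrightarrow> 0"
    using assms(1) by (simp add: almost_all_sums_of_two_squares_def)
  have "card {E \<in> sums_of_two_squares. E \<le> N \<and> \<not> Q E} \<le> card {E \<in> sums_of_two_squares. E \<le> N \<and> \<not> P E}" for N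
    by (rule card_mono) (use assms(2) in \<open>auto intro: finite_subset[of _ "{..N}"]\<close>)
  then show "\<forall>\<^sub>F N in sequentially.
      real (card {E \<in> sums_of_two_squares. E \<le> N \<and> \<not> Q E}) / real (card {E \<in> sums_of_two_squares. E \<le> N})
      \<le> real (card {E \<in> sums_of_two_squares. E \<le> N \<and> \<not> P E}) / real (card {E \<in> sums_of_two_squares. E \<le> N})"
    by (intro always_eventually allI divide_right_mono) auto
qed auto

theorem mainTheorem4:
  fixes \<epsilon> :: real
  assumes "\<epsilon> > 0"
  shows "\<exists>c>0. almost_all_sums_of_two_squares (\<lambda>E.
           \<forall>\<phi> C K. eigenfunction E \<phi> \<and> regular_arc_lift C K \<and> C \<subseteq> nodal_set \<phi> \<longrightarrow>
             curve_width K < c * sqrt (real E) powr (- 1 + \<epsilon>))"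
proof (intro exI conjI)
  \<comment> \<open>The factor 5 comes from \<open>M\<^sup>2 / d\<close> with \<open>M\<close> of order \<open>2 \<delta>\<close> and \<open>d\<close> of order \<open>1 - \<delta>\<close> in powers of \<open>sqrt E\<close>.\<close>
  define \<delta> where "\<delta> = min (\<epsilon> / 5) 1"
  have \<delta>: "0 < \<delta>" "\<delta> \<le> 1" "5 * \<delta> \<le> \<epsilon>" using assms by (auto simp: \<delta>_def)
  show "almost_all_sums_of_two_squares (\<lambda>E.
      \<forall>\<phi> C K. eigenfunction E \<phi> \<and> regular_arc_lift C K \<and> C \<subseteq> nodal_set \<phi> \<longrightarrow>
        curve_width K < 1052353 * sqrt (real E) powr (- 1 + \<epsilon>))"
  proof (rule almost_all_sums_of_two_squares_mono[OF almost_all_separated[OF \<delta>(1,2)]], intro allI impI, elim conjE)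
    fix E \<phi> C K
    assume "E \<in> sums_of_two_squares" and sep: "separated (sqrt (real E) powr (1 - \<delta>)) E"
      and arc: "eigenfunction E \<phi>" "regular_arc_lift C K" "C \<subseteq> nodal_set \<phi>"
    then have E: "E \<ge> 1" by (simp add: sums_of_two_squares_def)
    have "curve_width K \<le> 1052352 * sqrt (real E) powr (- 1 + 5 * \<delta>)"
      by (rule width_bound_of_separated[OF E \<delta>(1) sep arc])
    also have "\<dots> \<le> 1052352 * sqrt (real E) powr (- 1 + \<epsilon>)"
      using E \<delta>(3) by (intro mult_left_mono powr_mono) auto
    also have "\<dots> < 1052353 * sqrt (real E) powr (- 1 + \<epsilon>)" using E by simp
    finally show "curve_width K < 1052353 * sqrt (real E) powr (- 1 + \<epsilon>)" .
  qed
qed simp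

end
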